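(* Let $A$ be one of the complex 3-Lie algebras listed below, with basis $\{e_1,\dots,e_n\}$ ($n=3$ in (1), $n=4$ in (2)–(8)) and the indicated non-zero brackets of basis elements (up to skew-symmetry). For $r=\sum_{i,j}a^{ij}e_i\otimes e_j\in A\otimes A$ denote $$D^{ij}_{pq}:=a^{ip}a^{jq}-a^{jp}a^{iq},\qquad e_{ijk}:=e_i\wedge e_j\wedge e_k .$$ Let $r$ be a skew-symmetric ($a^{ij}=-a^{ji}$) solution of the 3-Lie classical Yang-Baxter equation $[[r,r,r]]=0$ in $A$. Then $(A,\Delta)$ is a local cocycle 3-Lie bialgebra, where $\Delta:A\to A\otimes A\otimes A$ is the linear map given by the following formulas. (1) $n=3$, $[e_1,e_2,e_3]=e_1$: $\Delta(e_1)=D^{23}_{23}e_{123}$, $\Delta(e_2)=-D^{13}_{23}e_{123}$, $\Delta(e_3)=D^{12}_{23}e_{123}$. (2) $[e_1,e_2,e_3]=e_4$, $[e_1,e_2,e_4]=e_3$, $[e_1,e_3,e_4]=e_2$, $[e_2,e_3,e_4]=e_1$: $\Delta(e_1)=(D^{34}_{34}-D^{24}_{24}+D^{23}_{23})e_{234}+(D^{24}_{12}-D^{34}_{13})e_{123}+(D^{23}_{12}-D^{34}_{14})e_{124}+(D^{23}_{13}-D^{24}_{14})e_{134}$, $\Delta(e_2)=(D^{34}_{34}-D^{13}_{13}+D^{14}_{14})e_{134}+(D^{34}_{23}-D^{14}_{12})e_{123}+(D^{34}_{24}-D^{13}_{12})e_{124}+(D^{14}_{24}-D^{13}_{23})e_{234}$,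 $\Delta(e_3)=(D^{12}_{12}-D^{24}_{24}+D^{14}_{14})e_{124}+(D^{14}_{13}-D^{24}_{23})e_{123}+(D^{12}_{13}-D^{24}_{34})e_{134}+(D^{12}_{23}-D^{14}_{34})e_{234}$, $\Delta(e_4)=(D^{12}_{12}-D^{13}_{13}+D^{23}_{23})e_{123}+(D^{23}_{24}-D^{13}_{14})e_{124}+(D^{23}_{34}-D^{12}_{14})e_{134}+(D^{13}_{34}-D^{12}_{24})e_{234}$. (3) $[e_1,e_2,e_3]=e_1$ (with $n=4$): $\Delta(e_1)=D^{23}_{23}e_{123}+D^{23}_{24}e_{124}+D^{23}_{34}e_{134}$, $\Delta(e_2)=-D^{13}_{23}e_{123}-D^{13}_{24}e_{124}-D^{13}_{34}e_{134}$, $\Delta(e_3)=D^{12}_{23}e_{123}+D^{12}_{24}e_{124}+D^{12}_{34}e_{134}$, $\Delta(e_4)=0$, and the parameters satisfy $a^{23}(a^{12}a^{34}-a^{13}a^{24}-a^{32}a^{14})=0$. (4) $[e_2,e_3,e_4]=e_1$: $\Delta(e_1)=0$, $\Delta(e_2)=D^{34}_{23}e_{123}+D^{34}_{24}e_{124}+D^{34}_{34}e_{134}$, $\Delta(e_3)=-D^{24}_{23}e_{123}-D^{24}_{24}e_{124}-D^{24}_{34}e_{134}$, $\Delta(e_4)=D^{23}_{23}e_{123}+D^{23}_{24}e_{124}+D^{23}_{34}e_{134}$. (5) $[e_2,e_3,e_4]=e_1$, $[e_1,e_3,e_4]=e_2$: $\Delta(e_1)=-D^{34}_{13}e_{123}-D^{34}_{14}e_{124}+D^{34}_{34}e_{234}$,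 $\Delta(e_2)=D^{34}_{23}e_{123}+D^{34}_{24}e_{124}+D^{34}_{34}e_{134}$, $\Delta(e_3)=(D^{14}_{13}-D^{24}_{23})e_{123}+(D^{14}_{14}-D^{24}_{24})e_{124}-D^{24}_{34}e_{134}-D^{14}_{34}e_{234}$, $\Delta(e_4)=(D^{23}_{23}-D^{13}_{13})e_{123}+(D^{23}_{24}-D^{13}_{14})e_{124}+D^{23}_{34}e_{134}+D^{13}_{34}e_{234}$. (6) $[e_2,e_3,e_4]=e_2$, $[e_1,e_3,e_4]=e_1$: $\Delta(e_1)=D^{34}_{23}e_{123}+D^{34}_{24}e_{124}+D^{34}_{34}e_{134}$, $\Delta(e_2)=-D^{34}_{13}e_{123}-D^{34}_{14}e_{124}+D^{34}_{34}e_{234}$, $\Delta(e_3)=(D^{24}_{13}-D^{14}_{23})e_{123}+(D^{24}_{14}-D^{14}_{24})e_{124}-D^{14}_{34}e_{134}-D^{24}_{34}e_{234}$, $\Delta(e_4)=(D^{13}_{23}-D^{23}_{13})e_{123}+(D^{13}_{24}-D^{23}_{14})e_{124}+D^{13}_{34}e_{134}+D^{23}_{34}e_{234}$, and the parameters satisfy $a^{34}(a^{12}a^{34}-a^{32}a^{14}+a^{42}a^{13})=0$. (7) $[e_2,e_3,e_4]=\alpha e_1+e_2$, $[e_1,e_3,e_4]=e_2$, with $\alpha\in\mathbb{C}$, $\alpha\ne0$: $\Delta(e_1)=-D^{34}_{13}e_{123}-D^{34}_{14}e_{124}+D^{34}_{34}e_{234}$, $\Delta(e_2)=(\alpha D^{34}_{23}-D^{34}_{13})e_{123}+(\alpha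 D^{34}_{24}-D^{34}_{14})e_{124}+\alpha D^{34}_{34}e_{134}+D^{34}_{34}e_{234}$, $\Delta(e_3)=(D^{24}_{13}+D^{14}_{13}-\alpha D^{24}_{23})e_{123}+(D^{24}_{14}+D^{14}_{14}-\alpha D^{24}_{24})e_{124}-\alpha D^{24}_{34}e_{134}-(D^{24}_{34}+D^{14}_{34})e_{234}$, $\Delta(e_4)=(\alpha D^{23}_{23}-D^{23}_{13}-D^{13}_{13})e_{123}+(\alpha D^{23}_{24}-D^{23}_{14}-D^{13}_{14})e_{124}+\alpha D^{23}_{34}e_{134}+(D^{23}_{34}+D^{13}_{34})e_{234}$, and the parameters satisfy $a^{34}(a^{12}a^{43}+a^{32}a^{14}-a^{42}a^{13})=0$. (8) $[e_1,e_2,e_4]=e_3$, $[e_1,e_3,e_4]=e_2$, $[e_2,e_3,e_4]=e_1$: $\Delta(e_1)=(D^{24}_{12}-D^{34}_{13})e_{123}+D^{34}_{41}e_{124}-D^{24}_{14}e_{134}+(D^{34}_{34}-D^{24}_{24})e_{234}$, $\Delta(e_2)=(D^{34}_{23}-D^{14}_{12})e_{123}+D^{34}_{24}e_{124}+(D^{34}_{34}+D^{14}_{14})e_{134}+D^{14}_{24}e_{234}$, $\Delta(e_3)=(D^{14}_{13}-D^{24}_{23})e_{123}+(D^{14}_{14}-D^{24}_{24})e_{124}-D^{24}_{34}e_{134}-D^{14}_{34}e_{234}$, $\Delta(e_4)=(D^{12}_{12}-D^{13}_{13}+D^{23}_{23})e_{123}+(D^{23}_{24}-D^{13}_{14})e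_{124}+(D^{23}_{34}-D^{12}_{14})e_{134}+(D^{13}_{34}-D^{12}_{24})e_{234}$.
   Context: A 3-Lie algebra is a vector space $A$ with a trilinear, totally skew-symmetric bracket $[\cdot,\cdot,\cdot]:\otimes^3A\to A$ such that for all $x_1,\dots,x_5\in A$: $[x_1,x_2,[x_3,x_4,x_5]]=[[x_1,x_2,x_3],x_4,x_5]+[x_3,[x_1,x_2,x_4],x_5]+[x_3,x_4,[x_1,x_2,x_5]]$. Put $\mathrm{ad}_{x,y}z=[x,y,z]$. For a representation $(V,\rho)$ of $A$ ($\rho:\otimes^2A\to\mathfrak{gl}(V)$), a linear map $f:A\to V$ is a 1-cocycle associated to $(V,\rho)$ if $f([x_1,x_2,x_3])=\rho(x_1,x_2)f(x_3)+\rho(x_2,x_3)f(x_1)+\rho(x_3,x_1)f(x_2)$ for all $x_1,x_2,x_3\in A$. A local cocycle 3-Lie bialgebra is a pair $(A,\Delta)$ where $A$ is a 3-Lie algebra and $\Delta=\Delta_1+\Delta_2+\Delta_3:A\to A\otimes A\otimes A$ is a linear map (with linear summands $\Delta_i$) such that $\Delta^*:A^*\otimes A^*\otimes A^*\to A^*$ (the dual map) defines a 3-Lie algebra structure on $A^*$, and $\Delta_1,\Delta_2,\Delta_3$ are 1-cocycles associated to the representations of $A$ on $A\otimes A\otimes A$ given by $\mathrm{ad}\otimes\mathrm{id}\otimes\mathrm{id}$, $\mathrm{id}\otimes\mathrm{ad}\otimes\mathrm{id}$, $\mathrm{id}\otimes\mathrm{id}\otimes\mathrm{ad}$, respectively.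 For $r=\sum_i x_i\otimes y_i\in A\otimes A$, $$[[r,r,r]]=\sum_{i,j,k}\big([x_i,x_j,x_k]\otimes y_i\otimes y_j\otimes y_k+x_i\otimes[y_i,x_j,x_k]\otimes y_j\otimes y_k+x_i\otimes x_j\otimes[y_i,y_j,x_k]\otimes y_k+x_i\otimes x_j\otimes x_k\otimes[y_i,y_j,y_k]\big)\in\otimes^4A.$$ Wedge convention: $v_1\wedge v_2\wedge v_3=\sum_{\sigma\in S_3}\mathrm{sgn}(\sigma)v_{\sigma(1)}\otimes v_{\sigma(2)}\otimes v_{\sigma(3)}$. *)

theory Defs
  imports Complex_Main "HOL-Library.Function_Algebras" "HOL-Combinatorics.Permutations"
begin

text \<open>A vector space is given by its scalar multiplication \<open>s\<close> and, where it is not a whole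
  type, a carrier set. Dual spaces and tensor powers consist of complex-valued functions with
  pointwise operations.\<close>

definition fscale :: "complex \<Rightarrow> ('b \<Rightarrow> complex) \<Rightarrow> 'b \<Rightarrow> complex" (infixr "*\<^sub>C" 75)
  where "c *\<^sub>C f = (\<lambda>x. c * f x)"

definition lin_on ::
  "(complex \<Rightarrow> 'a::ab_group_add \<Rightarrow> 'a) \<Rightarrow> 'a set \<Rightarrow> (complex \<Rightarrow> 'b::ab_group_add \<Rightarrow> 'b) \<Rightarrow> 'b set
    \<Rightarrow> ('a \<Rightarrow> 'b) \<Rightarrow> bool"
  where "lin_on s V s' W f \<longleftrightarrow>
    (\<forall>x\<in>V. f x \<in> W) \<and> (\<forall>x\<in>V. \<forall>y\<in>V. f (x + y) = f x + f y) \<and> (\<forall>c. \<forall>x\<in>V. f (s c x) = s' c (f x))"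

definition is_basis :: "(complex \<Rightarrow> 'a::ab_group_add \<Rightarrow> 'a) \<Rightarrow> (nat \<Rightarrow> 'a) \<Rightarrow> nat \<Rightarrow> bool"
  where "is_basis s e n \<longleftrightarrow> inj_on e {1..n} \<and> \<not> module.dependent s (e ` {1..n}) \<and>
    module.span s (e ` {1..n}) = UNIV"

subsection \<open>3-Lie algebras, representations, 1-cocycles\<close>

locale three_Lie_algebra = vector_space s
  for s :: "complex \<Rightarrow> 'a::ab_group_add \<Rightarrow> 'a" +
  fixes A :: "'a set" and br :: "'a \<Rightarrow> 'a \<Rightarrow> 'a \<Rightarrow> 'a"
  assumes carrier_subspace: "subspace A"
    and trilinear:
      "\<And>y z. y \<in> A \<Longrightarrow> z \<in> A \<Longrightarrow> lin_on s A s A (\<lambda>x. br x y z)"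
      "\<And>x z. x \<in> A \<Longrightarrow> z \<in> A \<Longrightarrow> lin_on s A s A (\<lambda>y. br x y z)"
      "\<And>x y. x \<in> A \<Longrightarrow> y \<in> A \<Longrightarrow> lin_on s A s A (\<lambda>z. br x y z)"
    and skew:
      "\<And>x y z. x \<in> A \<Longrightarrow> y \<in> A \<Longrightarrow> z \<in> A \<Longrightarrow> br y x z = - br x y z"
      "\<And>x y z. x \<in> A \<Longrightarrow> y \<in> A \<Longrightarrow> z \<in> A \<Longrightarrow> br x z y = - br x y z"
    and fundamental_identity:
      "\<And>x1 x2 x3 x4 x5. x1 \<in> A \<Longrightarrow> x2 \<in> A \<Longrightarrow> x3 \<in> A \<Longrightarrow> x4 \<in> A \<Longrightarrow> x5 \<in> A \<Longrightarrow>
        br x1 x2 (br x3 x4 x5) =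
          br (br x1 x2 x3) x4 x5 + br x3 (br x1 x2 x4) x5 + br x3 x4 (br x1 x2 x5)"

text \<open>A representation of \<open>(A, br)\<close> on \<open>V\<close> in the sense of Kasymov: \<open>\<rho>\<close> is bilinear and
  skew-symmetric with values in \<open>gl(V)\<close>, and the two compatibility conditions hold.\<close>

definition representation ::
  "(complex \<Rightarrow> 'a::ab_group_add \<Rightarrow> 'a) \<Rightarrow> 'a set \<Rightarrow> ('a \<Rightarrow> 'a \<Rightarrow> 'a \<Rightarrow> 'a) \<Rightarrow>
    (complex \<Rightarrow> 'v::ab_group_add \<Rightarrow> 'v) \<Rightarrow> 'v set \<Rightarrow> ('a \<Rightarrow> 'a \<Rightarrow> 'v \<Rightarrow> 'v) \<Rightarrow> bool"
  where "representation s A br s' V \<rho> \<longleftrightarrow>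
    vector_space s' \<and> module.subspace s' V \<and>
    (\<forall>x\<in>A. \<forall>y\<in>A. lin_on s' V s' V (\<rho> x y)) \<and>
    (\<forall>y\<in>A. \<forall>v\<in>V. lin_on s A s' V (\<lambda>x. \<rho> x y v)) \<and>
    (\<forall>x\<in>A. \<forall>y\<in>A. \<forall>v\<in>V. \<rho> y x v = - \<rho> x y v) \<and>
    (\<forall>x1\<in>A. \<forall>x2\<in>A. \<forall>x3\<in>A. \<forall>x4\<in>A. \<forall>v\<in>V.
      \<rho> x1 x2 (\<rho> x3 x4 v) - \<rho> x3 x4 (\<rho> x1 x2 v) = \<rho> (br x1 x2 x3) x4 v - \<rho> (br x1 x2 x4) x3 v \<and>
      \<rho> (br x1 x2 x3) x4 v = \<rho> x1 x2 (\<rho> x3 x4 v) + \<rho> x2 x3 (\<rho> x1 x4 v) + \<rho> x3 x1 (\<rho> x2 x4 v))"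

definition one_cocycle ::
  "(complex \<Rightarrow> 'a::ab_group_add \<Rightarrow> 'a) \<Rightarrow> 'a set \<Rightarrow> ('a \<Rightarrow> 'a \<Rightarrow> 'a \<Rightarrow> 'a) \<Rightarrow>
    (complex \<Rightarrow> 'v::ab_group_add \<Rightarrow> 'v) \<Rightarrow> 'v set \<Rightarrow> ('a \<Rightarrow> 'a \<Rightarrow> 'v \<Rightarrow> 'v) \<Rightarrow> ('a \<Rightarrow> 'v) \<Rightarrow> bool"
  where "one_cocycle s A br s' V \<rho> f \<longleftrightarrow>
    representation s A br s' V \<rho> \<and> lin_on s A s' V f \<and>
    (\<forall>x1\<in>A. \<forall>x2\<in>A. \<forall>x3\<in>A.
      f (br x1 x2 x3) = \<rho> x1 x2 (f x3) + \<rho> x2 x3 (f x1) + \<rho> x3 x1 (f x2))"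

subsection \<open>Dual space and tensor powers\<close>

definition dual :: "(complex \<Rightarrow> 'a::ab_group_add \<Rightarrow> 'a) \<Rightarrow> ('a \<Rightarrow> complex) set"
  where "dual s = {f. Vector_Spaces.linear s (*) f}"

text \<open>A tensor of order \<open>k\<close> is identified with the \<open>k\<close>-linear form it induces on the dual space
  (over a field this identification is injective), extended by \<open>0\<close> to all other lists;
  \<open>\<otimes>\<^sup>k A\<close> is the span of the pure tensors.\<close>

type_synonym 'a tensor = "('a \<Rightarrow> complex) list \<Rightarrow> complex"

definition pure_tensor :: "(complex \<Rightarrow> 'a::ab_group_add \<Rightarrow> 'a) \<Rightarrow> 'a list \<Rightarrow> 'a tensor"
  where "pure_tensor s xs = (\<lambda>fs. if length fs = length xs \<and> set fs \<subseteq> dual s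
    then \<Prod>i<length xs. (fs ! i) (xs ! i) else 0)"

definition tensor_power :: "(complex \<Rightarrow> 'a::ab_group_add \<Rightarrow> 'a) \<Rightarrow> nat \<Rightarrow> 'a tensor set"
  where "tensor_power s k = module.span fscale {pure_tensor s xs | xs. length xs = k}"

definition wedge :: "(complex \<Rightarrow> 'a::ab_group_add \<Rightarrow> 'a) \<Rightarrow> 'a list \<Rightarrow> 'a tensor"
  where "wedge s vs = (\<Sum>\<sigma> | \<sigma> permutes {..<length vs}.
    of_int (sign \<sigma>) *\<^sub>C pure_tensor s (map (\<lambda>i. vs ! \<sigma> i) [0..<length vs]))"

text \<open>The map \<open>id \<otimes> \<dots> \<otimes> T \<otimes> \<dots> \<otimes> id\<close> with \<open>T\<close> in position \<open>i\<close> (counted from \<open>0\<close>): on multilinear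
  forms it precomposes the \<open>i\<close>-th functional with \<open>T\<close>; see \<open>slot_map_pure_tensor\<close> below.\<close>

definition slot_map ::
  "(complex \<Rightarrow> 'a::ab_group_add \<Rightarrow> 'a) \<Rightarrow> nat \<Rightarrow> ('a \<Rightarrow> 'a) \<Rightarrow> 'a tensor \<Rightarrow> 'a tensor"
  where "slot_map s i T t = (\<lambda>fs. if set fs \<subseteq> dual s then t (fs[i := fs ! i \<circ> T]) else 0)"

subsection \<open>Local cocycle 3-Lie bialgebras\<close>

text \<open>The restriction of \<open>\<Delta>\<^sup>*\<close> to pure tensors, \<open>\<langle>\<Delta>\<^sup>*(f \<otimes> g \<otimes> h), x\<rangle> = \<langle>f \<otimes> g \<otimes> h, \<Delta> x\<rangle>\<close>.\<close>

definition dual_bracket ::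
  "('a \<Rightarrow> 'a tensor) \<Rightarrow> ('a \<Rightarrow> complex) \<Rightarrow> ('a \<Rightarrow> complex) \<Rightarrow> ('a \<Rightarrow> complex) \<Rightarrow> 'a \<Rightarrow> complex"
  where "dual_bracket \<Delta> f g h = (\<lambda>x. \<Delta> x [f, g, h])"

definition local_cocycle_bialgebra ::
  "(complex \<Rightarrow> 'a::ab_group_add \<Rightarrow> 'a) \<Rightarrow> ('a \<Rightarrow> 'a \<Rightarrow> 'a \<Rightarrow> 'a) \<Rightarrow> ('a \<Rightarrow> 'a tensor) \<Rightarrow> bool"
  where "local_cocycle_bialgebra s br \<Delta> \<longleftrightarrow>
    three_Lie_algebra s UNIV br \<and>
    lin_on s UNIV fscale (tensor_power s 3) \<Delta> \<and>
    three_Lie_algebra fscale (dual s) (dual_bracket \<Delta>) \<and>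
    (\<exists>\<Delta>1 \<Delta>2 \<Delta>3. (\<forall>x. \<Delta> x = \<Delta>1 x + \<Delta>2 x + \<Delta>3 x) \<and>
      one_cocycle s UNIV br fscale (tensor_power s 3) (\<lambda>x y. slot_map s 0 (br x y)) \<Delta>1 \<and>
      one_cocycle s UNIV br fscale (tensor_power s 3) (\<lambda>x y. slot_map s 1 (br x y)) \<Delta>2 \<and>
      one_cocycle s UNIV br fscale (tensor_power s 3) (\<lambda>x y. slot_map s 2 (br x y)) \<Delta>3)"

subsection \<open>The 3-Lie classical Yang-Baxter equation\<close>

definition tensor2_of :: "(complex \<Rightarrow> 'a::ab_group_add \<Rightarrow> 'a) \<Rightarrow> ('a \<times> 'a) list \<Rightarrow> 'a tensor"
  where "tensor2_of s xys = (\<Sum>(x, y)\<leftarrow>xys. pure_tensor s [x, y])"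

definition YB_sum ::
  "(complex \<Rightarrow> 'a::ab_group_add \<Rightarrow> 'a) \<Rightarrow> ('a \<Rightarrow> 'a \<Rightarrow> 'a \<Rightarrow> 'a) \<Rightarrow> ('a \<times> 'a) list \<Rightarrow> 'a tensor"
  where "YB_sum s br xys = (\<Sum>(x1, y1)\<leftarrow>xys. \<Sum>(x2, y2)\<leftarrow>xys. \<Sum>(x3, y3)\<leftarrow>xys.
    pure_tensor s [br x1 x2 x3, y1, y2, y3] + pure_tensor s [x1, br y1 x2 x3, y2, y3] +
    pure_tensor s [x1, x2, br y1 y2 x3, y3] + pure_tensor s [x1, x2, x3, br y1 y2 y3])"

text \<open>\<open>[[r,r,r]]\<close>, computed from some expression \<open>r = \<Sum> x\<^sub>i \<otimes> y\<^sub>i\<close>; the choice is immaterial by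
  \<open>YB_bracket_eq\<close> below.\<close>

definition YB_bracket ::
  "(complex \<Rightarrow> 'a::ab_group_add \<Rightarrow> 'a) \<Rightarrow> ('a \<Rightarrow> 'a \<Rightarrow> 'a \<Rightarrow> 'a) \<Rightarrow> 'a tensor \<Rightarrow> 'a tensor"
  where "YB_bracket s br r = YB_sum s br (SOME xys. tensor2_of s xys = r)"

subsection \<open>Consistency of the encodings\<close>

lemma vector_space_fscale: "vector_space (fscale :: complex \<Rightarrow> ('b \<Rightarrow> complex) \<Rightarrow> 'b \<Rightarrow> complex)"
  by unfold_locales (auto simp: fscale_def fun_eq_iff algebra_simps)

lemma dual_comp:
  assumes "f \<in> dual s" "lin_on s UNIV s UNIV T"
  shows "f \<circ> T \<in> dual s"
  using assms by (simp add: dual_def Vector_Spaces.linear_iff lin_on_def)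

lemma slot_map_pure_tensor:
  assumes "lin_on s UNIV s UNIV T" "i < length xs"
  shows "slot_map s i T (pure_tensor s xs) = pure_tensor s (xs[i := T (xs ! i)])"
proof
  fix fs :: "('a \<Rightarrow> complex) list"
  show "slot_map s i T (pure_tensor s xs) fs = pure_tensor s (xs[i := T (xs ! i)]) fs"
  proof (cases "length fs = length xs \<and> set fs \<subseteq> dual s")
    case True
    then have "fs ! i \<in> dual s" using assms(2) nth_mem by fastforce
    then have "fs ! i \<circ> T \<in> dual s" by (rule dual_comp[OF _ assms(1)])
    then have "set (fs[i := fs ! i \<circ> T]) \<subseteq> dual s"
      using True set_update_subset_insert by fastforce
    moreover have "(fs[i := fs ! i \<circ> T] ! j) (xs ! j) = (fs ! j) (xs[i := T (xs ! i)] ! j)"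
      if "j < length xs" for j
      using that True by (cases "j = i") auto
    ultimately show ?thesis using True by (simp add: slot_map_def pure_tensor_def)
  next
    case False
    then show ?thesis by (auto simp: slot_map_def pure_tensor_def)
  qed
qed

lemma slot_map_add: "slot_map s i T (t + u) = slot_map s i T t + slot_map s i T u"
  by (simp add: slot_map_def fun_eq_iff)

lemma slot_map_scale: "slot_map s i T (c *\<^sub>C t) = c *\<^sub>C slot_map s i T t"
  by (simp add: slot_map_def fun_eq_iff fscale_def)

lemma slot_map_zero: "slot_map s i T 0 = 0"
  by (simp add: slot_map_def fun_eq_iff)

lemma fscale_simps:
  "c *\<^sub>C (f + g) = c *\<^sub>C f + c *\<^sub>C g" "c *\<^sub>C (f - g) = c *\<^sub>C f - c *\<^sub>C g"
  "c *\<^sub>C (- f) = - (c *\<^sub>C f)" "c *\<^sub>C (0 :: 'b \<Rightarrow> complex) = 0" "c *\<^sub>C d *\<^sub>C f = d *\<^sub>C c *\<^sub>C f"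
  by (simp_all add: fscale_def fun_eq_iff algebra_simps)

lemma tensor_power_induct [consumes 1, case_names pure zero add scale]:
  assumes "t \<in> tensor_power s k"
    and "\<And>xs. length xs = k \<Longrightarrow> Q (pure_tensor s xs)"
    and "Q 0" and "\<And>t u. Q t \<Longrightarrow> Q u \<Longrightarrow> Q (t + u)" and "\<And>c t. Q t \<Longrightarrow> Q (c *\<^sub>C t)"
  shows "Q t"
proof -
  interpret F: vector_space "fscale :: complex \<Rightarrow> 'a tensor \<Rightarrow> 'a tensor"
    by (rule vector_space_fscale)
  have "t \<in> F.span {pure_tensor s xs | xs. length xs = k}"
    using assms(1) by (simp add: tensor_power_def)
  then show ?thesis
  proof (induction rule: F.span_induct_alt)
    case base
    show ?case by (rule assms(3))
  next
    case (step c x y)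
    then obtain xs where "length xs = k" "x = pure_tensor s xs" by blast
    then have "Q x" by (simp add: assms(2))
    then show ?case by (intro assms(4,5) step)
  qed
qed

lemma subspace_tensor_power: "module.subspace fscale (tensor_power s k)"
proof -
  interpret F: vector_space "fscale :: complex \<Rightarrow> 'a tensor \<Rightarrow> 'a tensor"
    by (rule vector_space_fscale)
  show ?thesis by (simp add: tensor_power_def)
qed

lemma pure_tensor_in_tensor_power: "length xs = k \<Longrightarrow> pure_tensor s xs \<in> tensor_power s k"
proof -
  interpret F: vector_space "fscale :: complex \<Rightarrow> 'a tensor \<Rightarrow> 'a tensor"
    by (rule vector_space_fscale)
  show "length xs = k \<Longrightarrow> pure_tensor s xs \<in> tensor_power s k"
    unfolding tensor_power_def by (rule F.span_base) auto
qed

lemma slot_map_in_tensor_power: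
  assumes "lin_on s UNIV s UNIV T" "i < k" "t \<in> tensor_power s k"
  shows "slot_map s i T t \<in> tensor_power s k"
proof -
  interpret F: vector_space "fscale :: complex \<Rightarrow> 'a tensor \<Rightarrow> 'a tensor"
    by (rule vector_space_fscale)
  have sub: "F.subspace (tensor_power s k)" by (rule subspace_tensor_power)
  show ?thesis
    using assms(3)
  proof (induction rule: tensor_power_induct)
    case (pure xs)
    then show ?case using assms(1,2) by (simp add: slot_map_pure_tensor pure_tensor_in_tensor_power)
  next
    case zero
    show ?case unfolding slot_map_zero by (rule F.subspace_0[OF sub])
  next
    case (add t u)
    then show ?case unfolding slot_map_add by (intro F.subspace_add[OF sub])
  next
    case (scale c t)
    then show ?case unfolding slot_map_scale by (intro F.subspace_scale[OF sub])
  qed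
qed

lemma pure_tensor_slot_linear:
  assumes "i < length xs"
  shows "pure_tensor s (xs[i := u + v]) = pure_tensor s (xs[i := u]) + pure_tensor s (xs[i := v])"
    and "pure_tensor s (xs[i := s c u]) = c *\<^sub>C pure_tensor s (xs[i := u])"
proof -
  have split: "(\<Prod>j<length xs. (fs ! j) (xs[i := w] ! j)) =
      (fs ! i) w * (\<Prod>j\<in>{..<length xs} - {i}. (fs ! j) (xs ! j))"
    for w and fs :: "('a \<Rightarrow> complex) list"
    using assms by (simp add: prod.remove[of "{..<length xs}" i])
  have "(fs ! i) (u + v) = (fs ! i) u + (fs ! i) v \<and> (fs ! i) (s c u) = c * (fs ! i) u"
    if "length fs = length xs" "set fs \<subseteq> dual s" for fs
  proof -
    have "fs ! i \<in> dual s" using that assms nth_mem by fastforce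
    then show ?thesis by (simp add: dual_def Vector_Spaces.linear_iff)
  qed
  then show "pure_tensor s (xs[i := u + v]) = pure_tensor s (xs[i := u]) + pure_tensor s (xs[i := v])"
    and "pure_tensor s (xs[i := s c u]) = c *\<^sub>C pure_tensor s (xs[i := u])"
    by (auto simp: pure_tensor_def fun_eq_iff fscale_def split algebra_simps)
qed

lemma representation_slot_ad:
  assumes "three_Lie_algebra s UNIV br" "i < k"
  shows "representation s UNIV br fscale (tensor_power s k) (\<lambda>x y. slot_map s i (br x y))"
proof -
  interpret L: three_Lie_algebra s UNIV br by (rule assms(1))
  have lin: "lin_on s UNIV s UNIV (br x y)" for x y
    using L.trilinear(3)[of x y] by simp
  have lin1: "br (x + x') y z = br x y z + br x' y z" "br (s c x) y z = s c (br x y z)" for x x' y z c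
    using L.trilinear(1)[of y z] by (auto simp: lin_on_def)
  have sk: "br y x z = - br x y z" "br x z y = - br x y z" for x y z
    by (rule L.skew; simp)+
  have FI: "br x1 x2 (br x3 x4 x5) = br (br x1 x2 x3) x4 x5 + br x3 (br x1 x2 x4) x5 + br x3 x4 (br x1 x2 x5)"
    for x1 x2 x3 x4 x5 by (rule L.fundamental_identity; simp)
  have id1: "br x1 x2 (br x3 x4 u) = br x3 x4 (br x1 x2 u) + br (br x1 x2 x3) x4 u + - br (br x1 x2 x4) x3 u"
    for x1 x2 x3 x4 u using FI[of x1 x2 x3 x4 u] sk(1)[of "br x1 x2 x4" x3 u] by (simp add: algebra_simps)
  have id2: "br (br x1 x2 x3) x4 u = br x1 x2 (br x3 x4 u) + br x2 x3 (br x1 x4 u) + br x3 x1 (br x2 x4 u)"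
    for x1 x2 x3 x4 u
  proof -
    have c: "br x y z = br y z x" for x y z using sk(1)[of x y z] sk(2)[of y x z] by simp
    have "br x4 u (br x1 x2 x3) = br (br x4 u x1) x2 x3 + br x1 (br x4 u x2) x3 + br x1 x2 (br x4 u x3)"
      by (rule FI)
    moreover have "br x4 u (br x1 x2 x3) = br (br x1 x2 x3) x4 u"
      by (rule c[symmetric])
    moreover have "br (br x4 u x1) x2 x3 = br x2 x3 (br x1 x4 u)"
      using c[of "br x4 u x1" x2 x3] c[of x1 x4 u] by simp
    moreover have "br x1 (br x4 u x2) x3 = br x3 x1 (br x2 x4 u)"
      using c[of x3 x1 "br x4 u x2"] c[of x2 x4 u] by simp
    moreover have "br x4 u x3 = br x3 x4 u"
      by (rule c[symmetric])
    ultimately show ?thesis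
      by simp
  qed
  have pm: "pure_tensor s (xs[i := - u]) = - pure_tensor s (xs[i := u])" if "i < length xs" for xs u
  proof -
    have "pure_tensor s (xs[i := s (-1) u]) = (-1) *\<^sub>C pure_tensor s (xs[i := u])"
      by (rule pure_tensor_slot_linear(2)[OF that])
    then show ?thesis by (simp add: fscale_def fun_eq_iff)
  qed
  note sl = slot_map_pure_tensor[OF lin]
  have li: "slot_map s i (br (x + x') y) t = slot_map s i (br x y) t + slot_map s i (br x' y) t"
    if "t \<in> tensor_power s k" for t x x' y
    using that
  proof (induction rule: tensor_power_induct)
    case (pure xs)
    then show ?case using assms(2) by (simp add: sl) (simp add: lin1 pure_tensor_slot_linear)
  next
    case zero
    show ?case by (simp only: slot_map_zero fscale_simps add_0_left minus_zero)
  next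
    case (add t u)
    then show ?case by (simp only: slot_map_add fscale_simps minus_add_distrib ac_simps)
  next
    case (scale c t)
    then show ?case by (simp only: slot_map_scale fscale_simps)
  qed
  have ls: "slot_map s i (br (s c x) y) t = c *\<^sub>C slot_map s i (br x y) t"
    if "t \<in> tensor_power s k" for t x y c
    using that
  proof (induction rule: tensor_power_induct)
    case (pure xs)
    then show ?case using assms(2) by (simp add: sl) (simp add: lin1 pure_tensor_slot_linear)
  next
    case zero
    show ?case by (simp only: slot_map_zero fscale_simps add_0_left minus_zero)
  next
    case (add t u)
    then show ?case by (simp only: slot_map_add fscale_simps minus_add_distrib ac_simps)
  next
    case (scale c t)
    then show ?case by (simp only: slot_map_scale fscale_simps)
  qed
  have ln: "slot_map s i (br y x) t = - slot_map s i (br x y) t"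
    if "t \<in> tensor_power s k" for t x y
    using that
  proof (induction rule: tensor_power_induct)
    case (pure xs)
    then show ?case using assms(2) sk(1)[of y x "xs ! i"] by (simp add: sl pm)
  next
    case zero
    show ?case by (simp only: slot_map_zero fscale_simps add_0_left minus_zero)
  next
    case (add t u)
    then show ?case by (simp only: slot_map_add fscale_simps minus_add_distrib ac_simps)
  next
    case (scale c t)
    then show ?case by (simp only: slot_map_scale fscale_simps)
  qed
  have r1: "slot_map s i (br x1 x2) (slot_map s i (br x3 x4) t) =
      slot_map s i (br x3 x4) (slot_map s i (br x1 x2) t) +
      slot_map s i (br (br x1 x2 x3) x4) t + - slot_map s i (br (br x1 x2 x4) x3) t"
    if "t \<in> tensor_power s k" for t x1 x2 x3 x4
    using that
  proof (induction rule: tensor_power_induct)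
    case (pure xs)
    then have i: "i < length xs" using assms(2) by simp
    have comp: "slot_map s i (br y1 y2) (slot_map s i (br y3 y4) (pure_tensor s xs)) =
        pure_tensor s (xs[i := br y1 y2 (br y3 y4 (xs ! i))])" for y1 y2 y3 y4
      using i by (simp add: sl)
    show ?case
      unfolding comp
      by (simp only: sl[OF i] id1[of x1 x2 x3 x4] pure_tensor_slot_linear(1)[OF i] pm[OF i])
  next
    case zero
    show ?case by (simp only: slot_map_zero fscale_simps add_0_left minus_zero)
  next
    case (add t u)
    then show ?case by (simp only: slot_map_add fscale_simps minus_add_distrib ac_simps)
  next
    case (scale c t)
    then show ?case by (simp only: slot_map_scale fscale_simps)
  qed
  have r2: "slot_map s i (br (br x1 x2 x3) x4) t =
      slot_map s i (br x1 x2) (slot_map s i (br x3 x4) t) +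
      slot_map s i (br x2 x3) (slot_map s i (br x1 x4) t) +
      slot_map s i (br x3 x1) (slot_map s i (br x2 x4) t)"
    if "t \<in> tensor_power s k" for t x1 x2 x3 x4
    using that
  proof (induction rule: tensor_power_induct)
    case (pure xs)
    then show ?case using assms(2) id2[of x1 x2 x3 x4 "xs ! i"]
      by (simp add: sl pure_tensor_slot_linear)
  next
    case zero
    show ?case by (simp only: slot_map_zero fscale_simps add_0_left minus_zero)
  next
    case (add t u)
    then show ?case by (simp only: slot_map_add fscale_simps minus_add_distrib ac_simps)
  next
    case (scale c t)
    then show ?case by (simp only: slot_map_scale fscale_simps)
  qed
  have sub: "a - b = c - d" if "a = b + c + - d" for a b c d :: "'a tensor"
    using that by (simp add: fun_eq_iff)
  show ?thesis
    unfolding representation_def lin_on_def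
    by (intro conjI ballI allI; (rule vector_space_fscale subspace_tensor_power slot_map_add
          slot_map_scale slot_map_in_tensor_power[OF lin assms(2)] li ls ln sub[OF r1] r2; assumption))
qed

text \<open>\<open>[[r,r,r]]\<close> does not depend on the expression of \<open>r\<close> as a sum of pure tensors.\<close>

lemma tensor2_of_apply:
  assumes "f \<in> dual s" "g \<in> dual s"
  shows "(\<Sum>(x, y)\<leftarrow>xys. f x * g y) = tensor2_of s xys [f, g]"
proof (induction xys)
  case (Cons p xys)
  have "pure_tensor s [fst p, snd p] [f, g] = f (fst p) * g (snd p)"
    using assms by (simp add: pure_tensor_def lessThan_Suc mult.commute)
  with Cons show ?case by (simp add: tensor2_of_def case_prod_beta)
qed (simp add: tensor2_of_def)

lemma sum_list_swap:
  "(\<Sum>x\<leftarrow>xs. \<Sum>y\<leftarrow>ys. f x y) = (\<Sum>y\<leftarrow>ys. \<Sum>x\<leftarrow>xs. f x y :: 'b::comm_monoid_add)"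
  by (induction xs) (simp_all add: sum_list_addf)

lemma sum_list3_cong:
  fixes T :: "'b \<Rightarrow> 'b \<Rightarrow> 'b \<Rightarrow> 'c::comm_monoid_add"
  assumes "\<And>b c. (\<Sum>a\<leftarrow>p. T a b c) = (\<Sum>a\<leftarrow>q. T a b c)"
    and "\<And>a c. (\<Sum>b\<leftarrow>p. T a b c) = (\<Sum>b\<leftarrow>q. T a b c)"
    and "\<And>a b. (\<Sum>c\<leftarrow>p. T a b c) = (\<Sum>c\<leftarrow>q. T a b c)"
  shows "(\<Sum>a\<leftarrow>p. \<Sum>b\<leftarrow>p. \<Sum>c\<leftarrow>p. T a b c) = (\<Sum>a\<leftarrow>q. \<Sum>b\<leftarrow>q. \<Sum>c\<leftarrow>q. T a b c)"
proof -
  have "(\<Sum>b\<leftarrow>p. \<Sum>c\<leftarrow>p. T a b c) = (\<Sum>b\<leftarrow>q. \<Sum>c\<leftarrow>q. T a b c)" for a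
    unfolding assms(3) sum_list_swap[where f = "T a"] assms(2) ..
  then have "(\<Sum>a\<leftarrow>p. \<Sum>b\<leftarrow>p. \<Sum>c\<leftarrow>p. T a b c) = (\<Sum>a\<leftarrow>p. \<Sum>b\<leftarrow>q. \<Sum>c\<leftarrow>q. T a b c)"
    by simp
  also have "\<dots> = (\<Sum>b\<leftarrow>q. \<Sum>c\<leftarrow>q. \<Sum>a\<leftarrow>p. T a b c)"
    by (subst sum_list_swap, subst sum_list_swap) (rule refl)
  also have "\<dots> = (\<Sum>b\<leftarrow>q. \<Sum>c\<leftarrow>q. \<Sum>a\<leftarrow>q. T a b c)"
    unfolding assms(1) ..
  also have "\<dots> = (\<Sum>a\<leftarrow>q. \<Sum>b\<leftarrow>q. \<Sum>c\<leftarrow>q. T a b c)"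
    by (subst (2) sum_list_swap, subst (1) sum_list_swap) (rule refl)
  finally show ?thesis .
qed

lemma sum_list_fun_apply:
  "(\<Sum>x\<leftarrow>xs. f x) a = (\<Sum>x\<leftarrow>xs. f x a :: 'b::comm_monoid_add)"
  by (induction xs) simp_all

lemma YB_sum_cong:
  assumes "three_Lie_algebra s UNIV br" "tensor2_of s p = tensor2_of s q"
  shows "YB_sum s br p = YB_sum s br q"
proof
  fix fs
  interpret L: three_Lie_algebra s UNIV br by (rule assms(1))
  have ad: "(\<lambda>x. f (br x y z)) \<in> dual s" "(\<lambda>x. f (br y x z)) \<in> dual s" "(\<lambda>x. f (br y z x)) \<in> dual s"
    if "f \<in> dual s" for f y z
    using dual_comp[OF that L.trilinear(1)[of y z]] dual_comp[OF that L.trilinear(2)[of y z]]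
      dual_comp[OF that L.trilinear(3)[of y z]] by (simp_all add: comp_def)
  have swap1: "(\<Sum>a\<leftarrow>p. c * (f (fst a) * g (snd a))) = (\<Sum>a\<leftarrow>q. c * (f (fst a) * g (snd a)))"
    if "f \<in> dual s" "g \<in> dual s" for c f g
    using tensor2_of_apply[OF that, unfolded case_prod_beta] assms(2)
    by (simp add: sum_list_const_mult)
  have swap: "(\<Sum>a\<leftarrow>p. G a) = (\<Sum>a\<leftarrow>q. G a)"
    if "\<And>a. G a = c1 * (g1 (fst a) * h1 (snd a)) + c2 * (g2 (fst a) * h2 (snd a)) +
        c3 * (g3 (fst a) * h3 (snd a)) + c4 * (g4 (fst a) * h4 (snd a))"
      "{g1, g2, g3, g4, h1, h2, h3, h4} \<subseteq> dual s"
    for G c1 c2 c3 c4 g1 g2 g3 g4 h1 h2 h3 h4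
    using that(2) unfolding that(1) sum_list_addf by (simp add: swap1)
  show "YB_sum s br p fs = YB_sum s br q fs"
  proof (cases "length fs = 4 \<and> set fs \<subseteq> dual s")
    case False
    then have "pure_tensor s [x1, x2, x3, x4] fs = 0" for x1 x2 x3 x4
      by (auto simp: pure_tensor_def)
    then have "YB_sum s br l fs = 0" for l
      by (simp add: YB_sum_def sum_list_fun_apply case_prod_beta)
    then show ?thesis by simp
  next
    case True
    then obtain f1 f2 f3 f4 where fs: "fs = [f1, f2, f3, f4]"
      by (auto simp: eval_nat_numeral length_Suc_conv)
    then have d: "f1 \<in> dual s" "f2 \<in> dual s" "f3 \<in> dual s" "f4 \<in> dual s" using True by auto
    define T where "T = (\<lambda>a b c.
      f1 (br (fst a) (fst b) (fst c)) * f2 (snd a) * f3 (snd b) * f4 (snd c) +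
      f1 (fst a) * f2 (br (snd a) (fst b) (fst c)) * f3 (snd b) * f4 (snd c) +
      f1 (fst a) * f2 (fst b) * f3 (br (snd a) (snd b) (fst c)) * f4 (snd c) +
      f1 (fst a) * f2 (fst b) * f3 (fst c) * f4 (br (snd a) (snd b) (snd c)))"
    have pt: "pure_tensor s [x1, x2, x3, x4] fs = f1 x1 * f2 x2 * f3 x3 * f4 x4" for x1 x2 x3 x4
      using d by (simp add: pure_tensor_def fs eval_nat_numeral lessThan_Suc)
    have YB: "YB_sum s br l fs = (\<Sum>a\<leftarrow>l. \<Sum>b\<leftarrow>l. \<Sum>c\<leftarrow>l. T a b c)" for l
      by (simp add: YB_sum_def sum_list_fun_apply case_prod_beta pt T_def)
    have "(\<Sum>a\<leftarrow>p. T a b c) = (\<Sum>a\<leftarrow>q. T a b c)" for b c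
      by (rule swap[of _ "f3 (snd b) * f4 (snd c)" "\<lambda>x. f1 (br x (fst b) (fst c))" f2
            "f3 (snd b) * f4 (snd c)" f1 "\<lambda>x. f2 (br x (fst b) (fst c))"
            "f2 (fst b) * f4 (snd c)" f1 "\<lambda>x. f3 (br x (snd b) (fst c))"
            "f2 (fst b) * f3 (fst c)" f1 "\<lambda>x. f4 (br x (snd b) (snd c))"])
        (simp_all add: T_def d ad)
    moreover have "(\<Sum>b\<leftarrow>p. T a b c) = (\<Sum>b\<leftarrow>q. T a b c)" for a c
      by (rule swap[of _ "f2 (snd a) * f4 (snd c)" "\<lambda>x. f1 (br (fst a) x (fst c))" f3
            "f1 (fst a) * f4 (snd c)" "\<lambda>x. f2 (br (snd a) x (fst c))" f3
            "f1 (fst a) * f4 (snd c)" f2 "\<lambda>x. f3 (br (snd a) x (fst c))"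
            "f1 (fst a) * f3 (fst c)" f2 "\<lambda>x. f4 (br (snd a) x (snd c))"])
        (simp_all add: T_def d ad)
    moreover have "(\<Sum>c\<leftarrow>p. T a b c) = (\<Sum>c\<leftarrow>q. T a b c)" for a b
      by (rule swap[of _ "f2 (snd a) * f3 (snd b)" "\<lambda>x. f1 (br (fst a) (fst b) x)" f4
            "f1 (fst a) * f3 (snd b)" "\<lambda>x. f2 (br (snd a) (fst b) x)" f4
            "f1 (fst a) * f2 (fst b)" "\<lambda>x. f3 (br (snd a) (snd b) x)" f4
            "f1 (fst a) * f2 (fst b)" f3 "\<lambda>x. f4 (br (snd a) (snd b) x)"])
        (simp_all add: T_def d ad)
    ultimately show ?thesis
      unfolding YB by (rule sum_list3_cong)
  qed
qed

lemma YB_bracket_eq: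
  assumes "three_Lie_algebra s UNIV br"
  shows "YB_bracket s br (tensor2_of s xys) = YB_sum s br xys"
proof -
  have "tensor2_of s (SOME xys'. tensor2_of s xys' = tensor2_of s xys) = tensor2_of s xys"
    by (rule someI[of _ xys]) simp
  then show ?thesis
    unfolding YB_bracket_def by (rule YB_sum_cong[OF assms])
qed

end

theory Submission
  imports Defs
begin

text \<open>Write \<open>r = \<Sum> x\<^sub>i \<otimes> y\<^sub>i\<close> and \<open>R f = \<Sum> f(y\<^sub>i) x\<^sub>i\<close>. Put
  \<open>\<Delta>\<^sub>1 x = \<Sum> [x, x\<^sub>i, x\<^sub>j] \<otimes> y\<^sub>i \<otimes> y\<^sub>j\<close>, which is a 1-cocycle because \<open>ad\<close> satisfies the fundamental
  identity; \<open>\<Delta>\<^sub>2\<close> and \<open>\<Delta>\<^sub>3\<close> arise by cyclic rotation. The bracket dual to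
  \<open>\<Delta> = \<Delta>\<^sub>1 + \<Delta>\<^sub>2 + \<Delta>\<^sub>3\<close> is \<open>{f, g, h}(x) = f [x, R g, R h] + g [x, R h, R f] + h [x, R f, R g]\<close>.
  For skew-symmetric \<open>r\<close> the Yang-Baxter equation says exactly \<open>R {f, g, h} = - [R f, R g, R h]\<close>,
  and then the fundamental identity on the dual space follows from identities in \<open>A\<close>, one for each
  of the five functionals. On a basis, \<open>\<Delta> x = \<Sum> D\<^sup>i\<^sup>k\<^sub>p\<^sub>q [x, e\<^sub>i, e\<^sub>k] \<and> e\<^sub>p \<and> e\<^sub>q\<close>
  over \<open>i < k\<close> and \<open>p < q\<close>, which gives the listed formulas.\<close>

subsection \<open>Dual spaces and 1-cocycles\<close>

text \<open>\<open>Vector_Spaces.linear\<close> carries the vector space axioms, so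
  \<open>f \<in> dual s\<close> alone supplies them for \<open>s\<close>; \<open>dual_uminus\<close>
  and \<open>dual_diff\<close> draw them from here.\<close>

lemma dual_iff:
  "f \<in> dual s \<longleftrightarrow> vector_space s \<and> (\<forall>x y. f (x + y) = f x + f y) \<and> (\<forall>c x. f (s c x) = c * f x)"
proof -
  have "vector_space ((*) :: complex \<Rightarrow> complex \<Rightarrow> complex)"
    by unfold_locales (auto simp: algebra_simps)
  then show ?thesis
    by (auto simp: dual_def Vector_Spaces.linear_iff)
qed

lemma subspace_dual:
  assumes "vector_space s"
  shows "module.subspace fscale (dual s)"
proof -
  interpret F: vector_space "fscale :: complex \<Rightarrow> ('a \<Rightarrow> complex) \<Rightarrow> 'a \<Rightarrow> complex"
    by (rule vector_space_fscale)
  show ?thesis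
    using assms by (auto simp: F.subspace_def dual_iff fscale_def algebra_simps)
qed

lemma lin_on_zero:
  assumes "module.subspace s' W" "vector_space s'"
  shows "lin_on s V s' W (\<lambda>_. 0)"
proof -
  interpret vector_space s' by (rule assms(2))
  show ?thesis using assms(1) by (simp add: lin_on_def subspace_0)
qed

lemma lin_on_add:
  assumes "module.subspace s' W" "vector_space s'" "lin_on s V s' W f" "lin_on s V s' W g"
  shows "lin_on s V s' W (\<lambda>x. f x + g x)"
proof -
  interpret vector_space s' by (rule assms(2))
  show ?thesis
    using assms(1,3,4) by (auto simp: lin_on_def subspace_add scale_right_distrib)
qed

lemma one_cocycle_zero:
  assumes "representation s A br s' V \<rho>"
  shows "one_cocycle s A br s' V \<rho> (\<lambda>_. 0)"
proof -
  have "\<rho> x y 0 = 0" if "x \<in> A" "y \<in> A" for x y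
  proof -
    have l: "lin_on s' V s' V (\<rho> x y)" and V: "vector_space s'" "module.subspace s' V"
      using assms that by (auto simp: representation_def)
    interpret vector_space s' by (rule V)
    have "0 \<in> V" using V(2) by (rule subspace_0)
    then have "\<rho> x y (0 + 0) = \<rho> x y 0 + \<rho> x y 0"
      using l unfolding lin_on_def by blast
    then show ?thesis by simp
  qed
  moreover have "lin_on s A s' V (\<lambda>_. 0)"
    using assms by (intro lin_on_zero) (auto simp: representation_def)
  ultimately show ?thesis
    using assms by (simp add: one_cocycle_def)
qed

lemma one_cocycle_add:
  assumes "one_cocycle s A br s' V \<rho> f" "one_cocycle s A br s' V \<rho> g"
  shows "one_cocycle s A br s' V \<rho> (\<lambda>x. f x + g x)"
proof -
  have rep: "representation s A br s' V \<rho>" and f: "lin_on s A s' V f" and g: "lin_on s A s' V g"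
    using assms by (auto simp: one_cocycle_def)
  have "\<rho> x y (f z + g z) = \<rho> x y (f z) + \<rho> x y (g z)" if "x \<in> A" "y \<in> A" "z \<in> A" for x y z
  proof -
    have "lin_on s' V s' V (\<rho> x y)"
      using rep that by (auto simp: representation_def)
    moreover have "f z \<in> V" "g z \<in> V"
      using f g that by (auto simp: lin_on_def)
    ultimately show ?thesis unfolding lin_on_def by blast
  qed
  moreover have "lin_on s A s' V (\<lambda>x. f x + g x)"
    using rep f g by (intro lin_on_add) (auto simp: representation_def)
  ultimately show ?thesis
    using assms by (simp add: one_cocycle_def ac_simps)
qed

text \<open>Reduces the cocycle condition for sums over the pairs of \<open>r\<close> to a single
  summand.\<close>

lemma one_cocycle_sum_list:
  assumes "representation s A br s' V \<rho>" "\<And>i. i \<in> set is \<Longrightarrow> one_cocycle s A br s' V \<rho> (f i)"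
  shows "one_cocycle s A br s' V \<rho> (\<lambda>x. \<Sum>i\<leftarrow>is. f i x)"
  using assms(2) by (induction "is") (simp_all add: one_cocycle_zero[OF assms(1)] one_cocycle_add)

lemma dual_zero: "f \<in> dual s \<Longrightarrow> f 0 = 0"
  unfolding dual_iff by (metis add_cancel_right_right)

lemma dual_uminus: "f \<in> dual s \<Longrightarrow> f (- x) = - f x"
  and dual_diff: "f \<in> dual s \<Longrightarrow> f (x - y) = f x - f y"
proof -
  assume f: "f \<in> dual s"
  then interpret vector_space s by (simp add: dual_iff)
  show *: "f (- x) = - f x" for x
    using f scale_minus_left[of 1 x] by (metis dual_iff mult_minus1 scale_one)
  show "f (x - y) = f x - f y"
    using f * unfolding diff_conv_add_uminus by (simp only: dual_iff)
qed

context three_Lie_algebra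
begin

lemma dual_sum_list:
  assumes "f \<in> dual s"
  shows "f (\<Sum>p\<leftarrow>ps. s (c p) (x p)) = (\<Sum>p\<leftarrow>ps. c p * f (x p))"
proof (induction ps)
  case Nil
  show ?case using assms by (simp add: dual_zero)
qed (use assms in \<open>simp add: dual_iff\<close>)

end

subsection \<open>Identities in 3-Lie algebras\<close>

text \<open>With the whole type as carrier, the membership premises disappear from all laws.\<close>

locale three_Lie_algebra_type = three_Lie_algebra s UNIV br
  for s :: "complex \<Rightarrow> 'a::ab_group_add \<Rightarrow> 'a" and br
begin

lemma br_linear:
  "br (x + x') y z = br x y z + br x' y z" "br (s c x) y z = s c (br x y z)"
  "br x (y + y') z = br x y z + br x y' z" "br x (s c y) z = s c (br x y z)"
  "br x y (z + z') = br x y z + br x y z'" "br x y (s c z) = s c (br x y z)"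
  using trilinear(1)[of y z] trilinear(2)[of x z] trilinear(3)[of x y]
  by (auto simp: lin_on_def)

lemma br_skew: "br y x z = - br x y z" "br x z y = - br x y z"
  by (rule skew; simp)+

lemma br_cycle: "br y z x = br x y z"
  using br_skew(1)[of y x z] br_skew(2)[of y x z] by simp

lemma br_alternating: "br x x y = 0" "br y x x = 0" "br x y x = 0"
proof -
  have self: "v = 0" if "v = - v" for v :: 'a
  proof -
    \<comment> \<open>Characteristic zero enters here: \<open>v = - v\<close> gives
      \<open>s 2 v = 0\<close>, and \<open>2\<close> is invertible.\<close>
    have "s 2 v = v + v" using scale_left_distrib[of 1 1 v] by simp
    also have "v + v = 0" using that by (metis add.right_inverse)
    finally show ?thesis by (simp only: scale_eq_0_iff) simp
  qed
  show *: "br x x y = 0" and "br y x x = 0"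
    by (rule self, rule br_skew)+
  then show "br x y x = 0" using br_skew(2)[of x x y] by simp
qed

lemma br_uminus: "br (- x) y z = - br x y z" "br x (- y) z = - br x y z" "br x y (- z) = - br x y z"
  using br_linear(2)[of "-1"] br_linear(4)[of _ "-1"] br_linear(6)[of _ _ "-1"] by simp_all

lemma br_FI:
  "br x1 x2 (br x3 x4 x5) = br (br x1 x2 x3) x4 x5 + br x3 (br x1 x2 x4) x5 + br x3 x4 (br x1 x2 x5)"
  by (rule fundamental_identity; simp)

text \<open>Rotation turns the left side into \<open>br x4 u (br x1 x2 x3)\<close>; the fundamental
  identity for the derivation \<open>br x4 u\<close> expands it, and rotating back gives the three
  terms. This is the cocycle identity for the map sending \<open>x\<close> to
  \<open>br x x4 u\<close>.\<close>

lemma br_br_left: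
  "br (br x1 x2 x3) x4 u = br x1 x2 (br x3 x4 u) + br x2 x3 (br x1 x4 u) + br x3 x1 (br x2 x4 u)"
proof -
  have "br x4 u (br x1 x2 x3) = br (br x4 u x1) x2 x3 + br x1 (br x4 u x2) x3 + br x1 x2 (br x4 u x3)"
    by (rule br_FI)
  moreover have "br x4 u (br x1 x2 x3) = br (br x1 x2 x3) x4 u"
    by (rule br_cycle)
  moreover have "br (br x4 u x1) x2 x3 = br x2 x3 (br x1 x4 u)"
    by (metis br_cycle)
  moreover have "br x1 (br x4 u x2) x3 = br x3 x1 (br x2 x4 u)"
    by (metis br_cycle)
  moreover have "br x4 u x3 = br x3 x4 u"
    by (rule br_cycle)
  ultimately show ?thesis
    by simp
qed

text \<open>Commuting \<open>ad\<close>'s by the fundamental identity and expanding the result with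
  \<open>br_br_left\<close> shows that the cyclic sum of anticommutators of \<open>ad\<close>'s vanishes.\<close>

lemma br_br_left':
  "br (br x3 x4 x5) x2 x = br x2 x3 (br x4 x5 x) + br x2 x4 (br x5 x3 x) + br x2 x5 (br x3 x4 x)"
    (is "?l = ?r")
proof -
  note sk = br_skew(1)[of x2 x3] br_skew(1)[of x2 x4] br_skew(1)[of x2 x5]
    br_skew(1)[of x3 x4] br_skew(1)[of x3 x5] br_skew(1)[of x4 x5]
  have "br x2 x3 (br x4 x5 x) = br (br x2 x3 x4) x5 x - br (br x2 x3 x5) x4 x + br x4 x5 (br x2 x3 x)"
    (is "?a = ?b") using br_FI[of x2 x3 x4 x5 x] br_skew(1)[of "br x2 x3 x5" x4 x] by simp
  moreover have "?l - ?r = ?a - ?b"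
    unfolding br_br_left
    by (simp add: sk br_uminus algebra_simps)
  ultimately show ?thesis by simp
qed

lemma br_dual:
  assumes "f \<in> dual s"
  shows "(\<lambda>x. f (br x y z)) \<in> dual s" "(\<lambda>x. f (br y x z)) \<in> dual s" "(\<lambda>x. f (br y z x)) \<in> dual s"
  using assms by (simp_all add: dual_iff br_linear)

text \<open>For fixed \<open>u\<close> and \<open>v\<close>, \<open>br_br_left\<close> is the
  cocycle condition for \<open>br x u v\<close> under \<open>ad\<close>; multilinearity of pure
  tensors carries it to slot \<open>i\<close>, the other slots being constant.\<close>

lemma one_cocycle_pure_tensor:
  assumes "i < length xs"
  shows "one_cocycle s UNIV br fscale (tensor_power s (length xs)) (\<lambda>x y. slot_map s i (br x y))
    (\<lambda>x. pure_tensor s (xs[i := br x u v]))"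
proof -
  have eq: "br (br x1 x2 x3) u v = br x1 x2 (br x3 u v) + br x2 x3 (br x1 u v) + br x3 x1 (br x2 u v)"
    for x1 x2 x3 by (rule br_br_left)
  have lin: "lin_on s UNIV s UNIV (br x y)" for x y
    using trilinear(3)[of x y] by simp
  show ?thesis
    unfolding one_cocycle_def
    using assms
    by (auto simp: representation_slot_ad[OF three_Lie_algebra_axioms] lin_on_def
        pure_tensor_in_tensor_power slot_map_pure_tensor[OF lin] br_linear
        pure_tensor_slot_linear eq)
qed

end

subsection \<open>The bialgebra of a skew-symmetric Yang-Baxter solution\<close>

text \<open>A list of pairs presenting \<open>r\<close> is fixed, so that \<open>R\<close> and the
  cocycles are finite sums over it. Skew-symmetry is expressed by values on functionals, since
  tensors are forms on the dual space.\<close>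

locale skew_YB_solution = three_Lie_algebra_type s br
  for s :: "complex \<Rightarrow> 'a::ab_group_add \<Rightarrow> 'a" and br +
  fixes xys :: "('a \<times> 'a) list"
  assumes r_skew: "\<And>f g. f \<in> dual s \<Longrightarrow> g \<in> dual s \<Longrightarrow>
      tensor2_of s xys [f, g] = - tensor2_of s xys [g, f]"
    and YB: "YB_sum s br xys = 0"
begin

section \<open>The operator \<open>R\<close> and the Yang-Baxter equation\<close>

definition R :: "('a \<Rightarrow> complex) \<Rightarrow> 'a"
  where "R g = (\<Sum>(x, y)\<leftarrow>xys. s (g y) x)"

lemma R_linear: "R (f + g) = R f + R g" "R (c *\<^sub>C f) = s c (R f)"
  by (simp_all add: R_def fscale_def case_prod_unfold scale_left_distrib sum_list_addf)
    (induction xys; simp add: scale_right_distrib)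

lemma sum_fst_R:
  assumes "f \<in> dual s"
  shows "(\<Sum>p\<leftarrow>xys. f (fst p) * g (snd p)) = f (R g)"
  by (simp add: R_def case_prod_unfold dual_sum_list[OF assms] mult.commute)

text \<open>Contracting the first slot of \<open>r\<close> instead of the second costs a sign, by
  skew-symmetry.\<close>

lemma sum_snd_R:
  assumes "f \<in> dual s" "g \<in> dual s"
  shows "(\<Sum>p\<leftarrow>xys. g (fst p) * f (snd p)) = - f (R g)"
  using tensor2_of_apply[OF assms, of xys] tensor2_of_apply[OF assms(2,1), of xys]
    r_skew[OF assms] sum_fst_R[OF assms(1), of g] by (simp add: case_prod_unfold)

text \<open>The summand is a free \<open>T\<close>, so that \<open>simp\<close> can match products
  in any order; \<open>k\<close> collects the factors that do not depend on the summation
  index.\<close>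

lemma sum_R_fst:
  assumes "f \<in> dual s" "\<And>p. T p = k * (f (fst p) * g (snd p))"
  shows "(\<Sum>p\<leftarrow>xys. T p) = k * f (R g)"
  using sum_fst_R[OF assms(1), of g] unfolding assms(2) by (simp add: sum_list_const_mult)

lemma sum_R_snd:
  assumes "f \<in> dual s" "g \<in> dual s" "\<And>p. T p = - k * (g (fst p) * f (snd p))"
  shows "(\<Sum>p\<leftarrow>xys. T p) = k * f (R g)"
  using sum_snd_R[OF assms(1,2)] unfolding assms(3) by (simp only: sum_list_const_mult) simp

lemma R_skew:
  assumes "f \<in> dual s" "g \<in> dual s"
  shows "g (R f) = - f (R g)"
  using sum_snd_R[OF assms] sum_fst_R[OF assms(2), of f] by simp

text \<open>Evaluated at the functionals, the four terms of the Yang-Baxter sum have zero, one, two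
  and three contractions through first slots. Each of these costs a sign, whence the alternating
  signs.\<close>

lemma YB_R:
  assumes d: "f1 \<in> dual s" "f2 \<in> dual s" "f3 \<in> dual s" "f4 \<in> dual s"
  shows "f1 (br (R f2) (R f3) (R f4)) - f2 (br (R f1) (R f3) (R f4)) +
    f3 (br (R f1) (R f2) (R f4)) - f4 (br (R f1) (R f2) (R f3)) = 0"
proof -
  have pt: "pure_tensor s [x1, x2, x3, x4] [f1, f2, f3, f4] = f1 x1 * f2 x2 * f3 x3 * f4 x4" for x1 x2 x3 x4
    using d by (simp add: pure_tensor_def eval_nat_numeral lessThan_Suc)
  \<comment> \<open>In \<open>t1c\<close> to \<open>t4a\<close> the digit is the term of the
    Yang-Baxter sum and the letter the summation variable, contracted from the innermost
    outwards.\<close>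
  have t1c: "(\<Sum>c\<leftarrow>xys. f1 (br (fst a) (fst b) (fst c)) * f2 (snd a) * f3 (snd b) * f4 (snd c)) =
      (f2 (snd a) * f3 (snd b)) * f1 (br (fst a) (fst b) (R f4))" for a b
    by (rule sum_R_fst[OF br_dual(3)[OF d(1)]]) simp
  have t1b: "(\<Sum>b\<leftarrow>xys. (f2 (snd a) * f3 (snd b)) * f1 (br (fst a) (fst b) (R f4))) =
      (f2 (snd a)) * f1 (br (fst a) (R f3) (R f4))" for a
    by (rule sum_R_fst[OF br_dual(2)[OF d(1)]]) simp
  have t1a: "(\<Sum>a\<leftarrow>xys. (f2 (snd a)) * f1 (br (fst a) (R f3) (R f4))) =
      1 * f1 (br (R f2) (R f3) (R f4))"
    by (rule sum_R_fst[OF br_dual(1)[OF d(1)]]) simp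
  have t2c: "(\<Sum>c\<leftarrow>xys. f1 (fst a) * f2 (br (snd a) (fst b) (fst c)) * f3 (snd b) * f4 (snd c)) =
      (f1 (fst a) * f3 (snd b)) * f2 (br (snd a) (fst b) (R f4))" for a b
    by (rule sum_R_fst[OF br_dual(3)[OF d(2)]]) simp
  have t2b: "(\<Sum>b\<leftarrow>xys. (f1 (fst a) * f3 (snd b)) * f2 (br (snd a) (fst b) (R f4))) =
      (f1 (fst a)) * f2 (br (snd a) (R f3) (R f4))" for a
    by (rule sum_R_fst[OF br_dual(2)[OF d(2)]]) simp
  have t2a: "(\<Sum>a\<leftarrow>xys. (f1 (fst a)) * f2 (br (snd a) (R f3) (R f4))) =
      (- 1) * f2 (br (R f1) (R f3) (R f4))"
    by (rule sum_R_snd[OF br_dual(1)[OF d(2)] d(1)]) simp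
  have t3c: "(\<Sum>c\<leftarrow>xys. f1 (fst a) * f2 (fst b) * f3 (br (snd a) (snd b) (fst c)) * f4 (snd c)) =
      (f1 (fst a) * f2 (fst b)) * f3 (br (snd a) (snd b) (R f4))" for a b
    by (rule sum_R_fst[OF br_dual(3)[OF d(3)]]) simp
  have t3b: "(\<Sum>b\<leftarrow>xys. (f1 (fst a) * f2 (fst b)) * f3 (br (snd a) (snd b) (R f4))) =
      (- f1 (fst a)) * f3 (br (snd a) (R f2) (R f4))" for a
    by (rule sum_R_snd[OF br_dual(2)[OF d(3)] d(2)]) simp
  have t3a: "(\<Sum>a\<leftarrow>xys. (- f1 (fst a)) * f3 (br (snd a) (R f2) (R f4))) =
      1 * f3 (br (R f1) (R f2) (R f4))"
    by (rule sum_R_snd[OF br_dual(1)[OF d(3)] d(1)]) simp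
  have t4c: "(\<Sum>c\<leftarrow>xys. f1 (fst a) * f2 (fst b) * f3 (fst c) * f4 (br (snd a) (snd b) (snd c))) =
      (- (f1 (fst a) * f2 (fst b))) * f4 (br (snd a) (snd b) (R f3))" for a b
    by (rule sum_R_snd[OF br_dual(3)[OF d(4)] d(3)]) simp
  have t4b: "(\<Sum>b\<leftarrow>xys. (- (f1 (fst a) * f2 (fst b))) * f4 (br (snd a) (snd b) (R f3))) =
      (f1 (fst a)) * f4 (br (snd a) (R f2) (R f3))" for a
    by (rule sum_R_snd[OF br_dual(2)[OF d(4)] d(2)]) simp
  have t4a: "(\<Sum>a\<leftarrow>xys. (f1 (fst a)) * f4 (br (snd a) (R f2) (R f3))) =
      (- 1) * f4 (br (R f1) (R f2) (R f3))"
    by (rule sum_R_snd[OF br_dual(1)[OF d(4)] d(1)]) simp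
  note t = t1c t1b t1a t2c t2b t2a t3c t3b t3a t4c t4b t4a
  have "0 = YB_sum s br xys [f1, f2, f3, f4]" by (simp add: YB)
  also have "\<dots> =
      (\<Sum>a\<leftarrow>xys. \<Sum>b\<leftarrow>xys. \<Sum>c\<leftarrow>xys. f1 (br (fst a) (fst b) (fst c)) * f2 (snd a) * f3 (snd b) * f4 (snd c)) +
      (\<Sum>a\<leftarrow>xys. \<Sum>b\<leftarrow>xys. \<Sum>c\<leftarrow>xys. f1 (fst a) * f2 (br (snd a) (fst b) (fst c)) * f3 (snd b) * f4 (snd c)) +
      (\<Sum>a\<leftarrow>xys. \<Sum>b\<leftarrow>xys. \<Sum>c\<leftarrow>xys. f1 (fst a) * f2 (fst b) * f3 (br (snd a) (snd b) (fst c)) * f4 (snd c)) +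
      (\<Sum>a\<leftarrow>xys. \<Sum>b\<leftarrow>xys. \<Sum>c\<leftarrow>xys. f1 (fst a) * f2 (fst b) * f3 (fst c) * f4 (br (snd a) (snd b) (snd c)))"
    by (simp only: YB_sum_def sum_list_fun_apply case_prod_unfold plus_fun_apply pt sum_list_addf)
  also have "\<dots> = f1 (br (R f2) (R f3) (R f4)) - f2 (br (R f1) (R f3) (R f4)) +
      f3 (br (R f1) (R f2) (R f4)) - f4 (br (R f1) (R f2) (R f3))"
    unfolding t by simp
  finally show ?thesis by simp
qed

section \<open>The three cocycles and the dual bracket\<close>

definition \<Delta>1 :: "'a \<Rightarrow> 'a tensor"
  where "\<Delta>1 x = (\<Sum>(x1, y1)\<leftarrow>xys. \<Sum>(x2, y2)\<leftarrow>xys. pure_tensor s [br x x1 x2, y1, y2])"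

text \<open>\<open>y1\<close> and \<open>y2\<close> follow the bracket in cyclic order, as in
  \<open>\<Delta>1\<close>. Exchanging them would reverse the sign, because the bracket is skew in
  \<open>x1\<close> and \<open>x2\<close>.\<close>

definition \<Delta>2 :: "'a \<Rightarrow> 'a tensor"
  where "\<Delta>2 x = (\<Sum>(x1, y1)\<leftarrow>xys. \<Sum>(x2, y2)\<leftarrow>xys. pure_tensor s [y2, br x x1 x2, y1])"

definition \<Delta>3 :: "'a \<Rightarrow> 'a tensor"
  where "\<Delta>3 x = (\<Sum>(x1, y1)\<leftarrow>xys. \<Sum>(x2, y2)\<leftarrow>xys. pure_tensor s [y1, y2, br x x1 x2])"

lemma one_cocycles:
  "one_cocycle s UNIV br fscale (tensor_power s 3) (\<lambda>x y. slot_map s 0 (br x y)) \<Delta>1"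
  "one_cocycle s UNIV br fscale (tensor_power s 3) (\<lambda>x y. slot_map s 1 (br x y)) \<Delta>2"
  "one_cocycle s UNIV br fscale (tensor_power s 3) (\<lambda>x y. slot_map s 2 (br x y)) \<Delta>3"
proof -
  have rep: "Defs.representation s UNIV br fscale (tensor_power s 3) (\<lambda>x y. slot_map s i (br x y))"
    if "i < 3" for i by (rule representation_slot_ad[OF three_Lie_algebra_axioms that])
  \<comment> \<open>The entry of \<open>[w1, w2, w3]\<close> at position \<open>i\<close> is a
    placeholder that the update overwrites.\<close>
  have c: "one_cocycle s UNIV br fscale (tensor_power s 3) (\<lambda>x y. slot_map s i (br x y))
      (\<lambda>x. pure_tensor s ([w1, w2, w3][i := br x u v]))" if "i < 3" for i u v w1 w2 w3
    using one_cocycle_pure_tensor[of i "[w1, w2, w3]" u v] that by (simp add: numeral_3_eq_3)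
  show "one_cocycle s UNIV br fscale (tensor_power s 3) (\<lambda>x y. slot_map s 0 (br x y)) \<Delta>1"
    unfolding \<Delta>1_def[abs_def] case_prod_unfold
    by (intro one_cocycle_sum_list rep) (use c[of 0] in simp_all)
  show "one_cocycle s UNIV br fscale (tensor_power s 3) (\<lambda>x y. slot_map s 1 (br x y)) \<Delta>2"
    unfolding \<Delta>2_def[abs_def] case_prod_unfold
    by (intro one_cocycle_sum_list rep) (use c[of 1] in simp_all)
  show "one_cocycle s UNIV br fscale (tensor_power s 3) (\<lambda>x y. slot_map s 2 (br x y)) \<Delta>3"
    unfolding \<Delta>3_def[abs_def] case_prod_unfold
    by (intro one_cocycle_sum_list rep) (use c[of 2] in \<open>simp_all add: eval_nat_numeral\<close>)
qed

definition \<Delta>r :: "'a \<Rightarrow> 'a tensor"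
  where "\<Delta>r x = \<Delta>1 x + \<Delta>2 x + \<Delta>3 x"

lemma lin_on_\<Delta>r: "lin_on s UNIV fscale (tensor_power s 3) \<Delta>r"
  using one_cocycles unfolding \<Delta>r_def[abs_def] one_cocycle_def
  by (intro lin_on_add subspace_tensor_power vector_space_fscale) auto

text \<open>Every contraction runs through second slots: \<open>x1\<close> and \<open>x2\<close>
  become \<open>R\<close> of the functionals that meet \<open>y1\<close> and \<open>y2\<close>,
  without signs.\<close>

lemma dual_bracket_\<Delta>r:
  assumes d: "f \<in> dual s" "g \<in> dual s" "h \<in> dual s"
  shows "dual_bracket \<Delta>r f g h =
    (\<lambda>x. f (br x (R g) (R h)) + g (br x (R h) (R f)) + h (br x (R f) (R g)))"
proof
  fix x
  show "dual_bracket \<Delta>r f g h x =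
    f (br x (R g) (R h)) + g (br x (R h) (R f)) + h (br x (R f) (R g))"
  proof -
    have pt: "pure_tensor s [u, v, w] [f, g, h] = f u * g v * h w" for u v w
      using d by (simp add: pure_tensor_def eval_nat_numeral lessThan_Suc)
    have 1: "(\<Sum>b\<leftarrow>xys. f (br x (fst a) (fst b)) * g (snd a) * h (snd b)) = g (snd a) * f (br x (fst a) (R h))" for a
      by (rule sum_R_fst[OF br_dual(3)[OF d(1)]]) simp
    have 2: "(\<Sum>a\<leftarrow>xys. g (snd a) * f (br x (fst a) (R h))) = 1 * f (br x (R g) (R h))"
      by (rule sum_R_fst[OF br_dual(2)[OF d(1)]]) simp
    have 3: "(\<Sum>b\<leftarrow>xys. f (snd b) * g (br x (fst a) (fst b)) * h (snd a)) = h (snd a) * g (br x (fst a) (R f))" for a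
      by (rule sum_R_fst[OF br_dual(3)[OF d(2)]]) simp
    have 4: "(\<Sum>a\<leftarrow>xys. h (snd a) * g (br x (fst a) (R f))) = 1 * g (br x (R h) (R f))"
      by (rule sum_R_fst[OF br_dual(2)[OF d(2)]]) simp
    have 5: "(\<Sum>b\<leftarrow>xys. f (snd a) * g (snd b) * h (br x (fst a) (fst b))) = f (snd a) * h (br x (fst a) (R g))" for a
      by (rule sum_R_fst[OF br_dual(3)[OF d(3)]]) simp
    have 6: "(\<Sum>a\<leftarrow>xys. f (snd a) * h (br x (fst a) (R g))) = 1 * h (br x (R f) (R g))"
      by (rule sum_R_fst[OF br_dual(2)[OF d(3)]]) simp
    show ?thesis
      by (simp add: dual_bracket_def \<Delta>r_def \<Delta>1_def \<Delta>2_def \<Delta>3_def sum_list_fun_apply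
          case_prod_unfold pt 1 2 3 4 5 6)
  qed
qed

lemma three_Lie_algebra_\<Delta>r: "three_Lie_algebra fscale (dual s) (dual_bracket \<Delta>r)"
proof -
  \<comment> \<open>\<open>B\<close> is the closed formula for the dual bracket; the two agree on
    \<open>dual s\<close>.\<close>
  define B where "B f g h x = f (br x (R g) (R h)) + g (br x (R h) (R f)) + h (br x (R f) (R g))"
    for f g h :: "'a \<Rightarrow> complex" and x
  have DB: "dual_bracket \<Delta>r f g h = B f g h" if "f \<in> dual s" "g \<in> dual s" "h \<in> dual s" for f g h
    using dual_bracket_\<Delta>r[OF that] by (simp add: B_def fun_eq_iff)
  have B_dual: "B f g h \<in> dual s" if "f \<in> dual s" "g \<in> dual s" "h \<in> dual s" for f g h
    using that by (simp add: B_def dual_iff br_linear algebra_simps)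
  \<comment> \<open>The Yang-Baxter equation as compatibility of \<open>R\<close> with the brackets,
    tested against \<open>\<phi>\<close>: by \<open>R_skew\<close> the left side is
    \<open>- B f g h (R \<phi>)\<close>, and \<open>YB_R\<close> evaluates that.\<close>
  have R_B: "\<phi> (R (B f g h)) = - \<phi> (br (R f) (R g) (R h))"
    if d: "\<phi> \<in> dual s" "f \<in> dual s" "g \<in> dual s" "h \<in> dual s" for \<phi> f g h
  proof -
    have "g (br (R \<phi>) (R h) (R f)) = - g (br (R \<phi>) (R f) (R h))"
      using d(3) br_skew(2)[of "R \<phi>" "R f" "R h"] by (simp add: dual_uminus)
    then have "B f g h (R \<phi>) = \<phi> (br (R f) (R g) (R h))"
      unfolding B_def using YB_R[OF d] by algebra
    then show ?thesis
      using R_skew[OF B_dual[OF d(2,3,4)] d(1)] by simp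
  qed
  \<comment> \<open>This is \<open>br_br_left'\<close> after moving the bracket of \<open>v\<close>,
    \<open>w\<close>, \<open>z\<close> to the front; on the right, \<open>x\<close> lies in the
    inner bracket of every term.\<close>
  have K: "br x u (br v w z) = - br (br x w z) u v - br (br x z v) u w - br (br x v w) u z" for x u v w z
  proof -
    have "br x u (br v w z) = - br (br v w z) u x"
      by (metis br_cycle br_skew)
    then show ?thesis
      unfolding br_br_left'[of v w z u x] by (simp add: br_cycle[of x] br_cycle[of _ u] algebra_simps) (metis br_cycle)
  qed
  \<comment> \<open>The fundamental identity for the derivation \<open>br u v\<close> applied to
    \<open>br x w z\<close>, solved for the term in which it hits \<open>x\<close>.\<close>
  have L: "br (br x u v) w z = br (br x w z) u v - br x (br u v w) z - br x w (br u v z)" for x u v w z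
    using br_FI[of u v x w z] br_cycle[of u v x] br_cycle[of u v "br x w z"] by simp
  have FI: "B f1 f2 (B f3 f4 f5) = B (B f1 f2 f3) f4 f5 + B f3 (B f1 f2 f4) f5 + B f3 f4 (B f1 f2 f5)"
    if d: "f1 \<in> dual s" "f2 \<in> dual s" "f3 \<in> dual s" "f4 \<in> dual s" "f5 \<in> dual s" for f1 f2 f3 f4 f5
  proof
    fix x
    \<comment> \<open>\<open>R_B\<close> compares values of functionals only, so it is applied to
      the functionals obtained from \<open>f\<close> by fixing two arguments of the bracket.\<close>
    have RB: "f (br x y (R (B g h k))) = - f (br x y (br (R g) (R h) (R k)))"
        "f (br x (R (B g h k)) y) = - f (br x (br (R g) (R h) (R k)) y)"
      if "f \<in> dual s" "g \<in> dual s" "h \<in> dual s" "k \<in> dual s" for f g h k y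
      using that R_B[OF br_dual(3)] R_B[OF br_dual(2)] by blast+
    have k: "f (br x u (br v w z)) = - f (br (br x w z) u v) - f (br (br x z v) u w) - f (br (br x v w) u z)"
      and l: "f (br (br x u v) w z) = f (br (br x w z) u v) - f (br x (br u v w) z) - f (br x w (br u v z))"
      if "f \<in> dual s" for f u v w z
      unfolding K[of x u v w z] L[of x u v w z] using that by (simp_all add: dual_diff dual_uminus)
    \<comment> \<open>These reorder arguments so that the terms under \<open>f2\<close> match the
      instance of \<open>k\<close>.\<close>
    have sk: "f (br x (br v w z) u) = - f (br x u (br v w z))" "f (br (br x v w) u z) = - f (br (br x v w) z u)"
      if "f \<in> dual s" for f u v w z
      using br_skew(2)[of x u "br v w z"] br_skew(2)[of "br x v w" z u] that by (simp_all add: dual_uminus)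
    \<comment> \<open>The coefficients of \<open>f1\<close>, \<open>f2\<close> agree by \<open>K\<close>, those of \<open>f3\<close>, \<open>f4\<close>, \<open>f5\<close> by \<open>L\<close>.\<close>
    show "B f1 f2 (B f3 f4 f5) x = (B (B f1 f2 f3) f4 f5 + B f3 (B f1 f2 f4) f5 + B f3 f4 (B f1 f2 f5)) x"
      using k[OF d(1), of "R f2" "R f3" "R f4" "R f5"] k[OF d(2), of "R f1" "R f3" "R f4" "R f5"]
        l[OF d(3), of "R f1" "R f2" "R f4" "R f5"] l[OF d(4), of "R f1" "R f2" "R f5" "R f3"]
        l[OF d(5), of "R f1" "R f2" "R f3" "R f4"]
        sk(1)[OF d(2), of "R f3" "R f4" "R f5" "R f1"]
        sk(2)[OF d(2), of "R f4" "R f5" "R f1" "R f3"]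
        sk(2)[OF d(2), of "R f5" "R f3" "R f1" "R f4"]
        sk(2)[OF d(2), of "R f3" "R f4" "R f1" "R f5"]
      by (simp add: B_def[of _ _ _ x] RB d) (simp add: B_def)
  qed
  have sub: "module.subspace fscale (dual s)"
    by (rule subspace_dual) unfold_locales
  interpret F: vector_space "fscale :: complex \<Rightarrow> ('a \<Rightarrow> complex) \<Rightarrow> 'a \<Rightarrow> complex"
    by (rule vector_space_fscale)
  have add: "f + g \<in> dual s" and scale: "c *\<^sub>C f \<in> dual s" if "f \<in> dual s" "g \<in> dual s" for f g c
    using F.subspace_add[OF sub that] F.subspace_scale[OF sub that(1)] by auto
  show ?thesis
  proof (unfold_locales, goal_cases)
    case 1
    show ?case by (rule sub)
  next
    case (2 y z)
    then show ?case
      by (auto simp: lin_on_def DB B_dual add scale)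
        (auto simp: B_def fun_eq_iff fscale_def R_linear[unfolded fscale_def] br_linear dual_iff algebra_simps)
  next
    case (3 x z)
    then show ?case
      by (auto simp: lin_on_def DB B_dual add scale)
        (auto simp: B_def fun_eq_iff fscale_def R_linear[unfolded fscale_def] br_linear dual_iff algebra_simps)
  next
    case (4 x y)
    then show ?case
      by (auto simp: lin_on_def DB B_dual add scale)
        (auto simp: B_def fun_eq_iff fscale_def R_linear[unfolded fscale_def] br_linear dual_iff algebra_simps)
  next
    case (5 x y z)
    then show ?case
      by (simp add: DB) (simp add: B_def fun_eq_iff br_skew(2)[of _ "R y"] br_skew(2)[of _ "R z" "R x"] dual_uminus)
  next
    case (6 x y z)
    then show ?case
      by (simp add: DB) (simp add: B_def fun_eq_iff br_skew(2)[of _ "R y"] br_skew(2)[of _ "R z" "R x"] dual_uminus)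
  next
    case (7 x1 x2 x3 x4 x5)
    then show ?case
      by (simp only: DB B_dual) (rule FI)
  qed
qed

theorem local_cocycle_bialgebra_\<Delta>r: "local_cocycle_bialgebra s br \<Delta>r"
  unfolding local_cocycle_bialgebra_def
  using lin_on_\<Delta>r three_Lie_algebra_\<Delta>r one_cocycles \<Delta>r_def three_Lie_algebra_axioms by blast

end

subsection \<open>Coordinates\<close>

text \<open>The permutations of \<open>{0, 1, 2}\<close> arise by adjoining one point at a time:
  each is a transposition (possibly trivial) composed with a permutation of the smaller set,
  starting from the identity on \<open>{2}\<close>.\<close>

lemma wedge3:
  "wedge s [u, v, w] =
    pure_tensor s [u, v, w] - pure_tensor s [u, w, v] - pure_tensor s [v, u, w] +
    pure_tensor s [v, w, u] + pure_tensor s [w, u, v] - pure_tensor s [w, v, u]"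
proof -
  have f: "finite {1, 2::nat}" "0 \<notin> {1, 2::nat}" "finite {2::nat}" "1 \<notin> {2::nat}" by auto
  have p: "{p. p permutes {2::nat}} = {id}" by (auto simp: permutes_sing)
  have l: "{..<length [u, v, w]} = {0, 1, 2}" by auto
  show ?thesis
    unfolding wedge_def l sum_over_permutations_insert[OF f(1,2)]
      sum_over_permutations_insert[OF f(3,4)] p
    by (simp add: sign_swap_id permutation_swap_id sign_compose sign_id transpose_def fscale_def
        fun_eq_iff upt_rec)
qed

lemma wedge3_apply:
  "wedge s [u, v, w] [f, g, h] = (if {f, g, h} \<subseteq> dual s then
    f u * g v * h w - f u * g w * h v - f v * g u * h w + f v * g w * h u +
    f w * g u * h v - f w * g v * h u else 0)"
  by (simp add: wedge3 pure_tensor_def lessThan_Suc eval_nat_numeral algebra_simps)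

lemma wedge3_outside:
  assumes "length fs \<noteq> 3 \<or> \<not> set fs \<subseteq> dual s"
  shows "wedge s [u, v, w] fs = 0"
  using assms by (auto simp: wedge3 pure_tensor_def)

text \<open>Tensors are total functions on lists of functionals, so agreement must also be checked
  outside the lists of three elements of \<open>dual s\<close>.\<close>

lemma tensor3_eqI:
  assumes "\<And>fs. length fs \<noteq> 3 \<or> \<not> set fs \<subseteq> dual s \<Longrightarrow> t fs = u fs"
    and "\<And>f g h. f \<in> dual s \<Longrightarrow> g \<in> dual s \<Longrightarrow> h \<in> dual s \<Longrightarrow> t [f, g, h] = u [f, g, h]"
  shows "t = u"
proof
  fix fs
  show "t fs = u fs"
  proof (cases "length fs = 3 \<and> set fs \<subseteq> dual s")
    case True
    then obtain f g h where "fs = [f, g, h]"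
      by (auto simp: eval_nat_numeral length_Suc_conv)
    with True assms(2) show ?thesis by simp
  qed (use assms(1) in blast)
qed

lemma wedge3_skew:
  "wedge s [v, u, w] = - wedge s [u, v, w]" "wedge s [u, w, v] = - wedge s [u, v, w]"
  by (simp_all add: wedge3)

lemma wedge3_same: "wedge s [u, u, v] = 0" "wedge s [u, v, u] = 0" "wedge s [v, u, u] = 0"
  by (simp_all add: wedge3)

lemma wedge3_linear:
  "wedge s [u + u', v, w] = wedge s [u, v, w] + wedge s [u', v, w]"
  "wedge s [s c u, v, w] = c *\<^sub>C wedge s [u, v, w]"
  by (rule tensor3_eqI[of s]; simp add: wedge3_outside wedge3_apply fscale_def; simp add: dual_iff algebra_simps)+

lemma wedge3_uminus: "vector_space s \<Longrightarrow> wedge s [- u, v, w] = - wedge s [u, v, w]"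
  by (rule tensor3_eqI[of s]) (simp_all add: wedge3_outside wedge3_apply dual_uminus algebra_simps)

lemma wedge3_zero: "vector_space s \<Longrightarrow> wedge s [0, v, w] = 0"
  using wedge3_uminus[of s 0 v w] by (simp add: fun_eq_iff)

lemma sum_fun_apply: "(\<Sum>i\<in>A. f i) x = (\<Sum>i\<in>A. f i x :: 'b::comm_monoid_add)"
  by (induction A rule: infinite_finite_induct) simp_all

text \<open>Pairs each term above the diagonal with its mirror image. This serves both the pairs of
  bracket arguments and the columns of the minors.\<close>

lemma sum_off_diagonal:
  fixes T :: "nat \<Rightarrow> nat \<Rightarrow> 'b::ab_group_add"
  assumes "\<And>i. T i i = 0"
  shows "(\<Sum>i=1..n. \<Sum>k=1..n. T i k) = (\<Sum>i=1..n. \<Sum>k=Suc i..n. T i k + T k i)"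
proof (induction n)
  case (Suc n)
  have "(\<Sum>i=1..n. \<Sum>k=Suc i..Suc n. T i k + T k i) =
      (\<Sum>i=1..n. (\<Sum>k=Suc i..n. T i k + T k i) + (T i (Suc n) + T (Suc n) i))"
    by (intro sum.cong refl) simp
  with Suc assms show ?case
    by (simp add: sum.distrib ac_simps)
qed simp

section \<open>Solutions given by a skew-symmetric matrix\<close>

locale skew_YB_matrix = three_Lie_algebra_type s br
  for s :: "complex \<Rightarrow> 'a::ab_group_add \<Rightarrow> 'a" and br +
  fixes n :: nat and e :: "nat \<Rightarrow> 'a" and a :: "nat \<Rightarrow> nat \<Rightarrow> complex"
  assumes basis: "is_basis s e n"
    and a_skew: "\<And>i j. i \<in> {1..n} \<Longrightarrow> j \<in> {1..n} \<Longrightarrow> a i j = - a j i"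
    and YB_bracket: "YB_bracket s br (\<Sum>i=1..n. \<Sum>j=1..n. a i j *\<^sub>C pure_tensor s [e i, e j]) = 0"
begin

text \<open>The coefficients of \<open>r\<close> are absorbed into the first factors;
  \<open>[1..<Suc n]\<close> lists the indices \<open>1\<close> to \<open>n\<close>.\<close>

definition xys :: "('a \<times> 'a) list"
  where "xys = map (\<lambda>(i, j). (s (a i j) (e i), e j)) (List.product [1..<Suc n] [1..<Suc n])"

lemma sum_list_xys:
  "(\<Sum>p\<leftarrow>xys. T p) = (\<Sum>i=1..n. \<Sum>j=1..n. T (s (a i j) (e i), e j))"
proof -
  have "(\<Sum>p\<leftarrow>xys. T p) = (\<Sum>p\<leftarrow>List.product [1..<Suc n] [1..<Suc n]. T (s (a (fst p) (snd p)) (e (fst p)), e (snd p)))"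
    by (simp add: xys_def comp_def case_prod_unfold)
  also have "\<dots> = (\<Sum>p\<in>{1..n} \<times> {1..n}. T (s (a (fst p) (snd p)) (e (fst p)), e (snd p)))"
    by (subst sum_list_distinct_conv_sum_set) (auto simp: distinct_product atLeastLessThanSuc_atLeastAtMost simp del: upt_Suc)
  finally show ?thesis
    by (simp add: sum.cartesian_product case_prod_unfold)
qed

lemma tensor2_of_xys: "tensor2_of s xys = (\<Sum>i=1..n. \<Sum>j=1..n. a i j *\<^sub>C pure_tensor s [e i, e j])"
proof -
  have "pure_tensor s [s c u, v] = c *\<^sub>C pure_tensor s [u, v]" for c u v
    using pure_tensor_slot_linear(2)[of 0 "[u, v]" s c u] by simp
  then show ?thesis
    by (simp add: tensor2_of_def sum_list_xys)
qed

sublocale skew_YB_solution s br xys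
proof
  fix f g assume d: "f \<in> dual s" "g \<in> dual s"
  have pt: "pure_tensor s [u, v] [f', g'] = f' u * g' v" if "f' \<in> dual s" "g' \<in> dual s" for u v f' g'
    using that by (simp add: pure_tensor_def eval_nat_numeral lessThan_Suc)
  have "tensor2_of s xys [f, g] = (\<Sum>i=1..n. \<Sum>j=1..n. a i j * (f (e i) * g (e j)))"
    by (simp add: tensor2_of_xys sum_fun_apply fscale_def pt d)
  also have "\<dots> = (\<Sum>j=1..n. \<Sum>i=1..n. - (a j i * (g (e j) * f (e i))))"
  proof (subst sum.swap, intro sum.cong refl)
    fix i j assume "j \<in> {1..n}" "i \<in> {1..n}"
    then show "a i j * (f (e i) * g (e j)) = - (a j i * (g (e j) * f (e i)))"
      using a_skew[of i j] by simp
  qed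
  also have "\<dots> = - tensor2_of s xys [g, f]"
    by (simp add: tensor2_of_xys sum_fun_apply fscale_def pt d sum_negf)
  finally show "tensor2_of s xys [f, g] = - tensor2_of s xys [g, f]" .
next
  \<comment> \<open>\<open>YB_bracket_eq\<close> replaces the arbitrary expression chosen inside
    \<open>YB_bracket\<close> by the list \<open>xys\<close>.\<close>
  show "YB_sum s br xys = 0"
    using YB_bracket YB_bracket_eq[OF three_Lie_algebra_axioms, of xys] by (simp add: tensor2_of_xys)
qed

text \<open>The \<open>i\<close>-th coordinate of \<open>R f\<close>.\<close>

definition \<rho> :: "('a \<Rightarrow> complex) \<Rightarrow> nat \<Rightarrow> complex"
  where "\<rho> f i = (\<Sum>j=1..n. a i j * f (e j))"

lemma R_eq: "R f = (\<Sum>i=1..n. s (\<rho> f i) (e i))"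
  by (simp add: R_def case_prod_unfold sum_list_xys \<rho>_def scale_sum_left mult.commute)

lemma dual_R:
  assumes "f \<in> dual s"
  shows "f (R g) = (\<Sum>i=1..n. \<rho> g i * f (e i))"
proof -
  interpret C: vector_space "(*) :: complex \<Rightarrow> complex \<Rightarrow> complex"
    by unfold_locales (auto simp: algebra_simps)
  interpret f: Vector_Spaces.linear s "(*)" f
    using assms by (simp add: dual_def)
  show ?thesis by (simp add: R_eq f.sum f.scale)
qed

definition D :: "nat \<Rightarrow> nat \<Rightarrow> nat \<Rightarrow> nat \<Rightarrow> complex"
  where "D i j p q = a i p * a j q - a j p * a i q"

text \<open>The Cauchy-Binet formula for a two-by-two minor of the product of \<open>a\<close> with
  the matrix whose columns are the values of \<open>g\<close> and \<open>h\<close> on the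
  basis.\<close>

lemma minor_\<rho>:
  "\<rho> g i * \<rho> h k - \<rho> g k * \<rho> h i =
    (\<Sum>p=1..n. \<Sum>q=Suc p..n. D i k p q * (g (e p) * h (e q) - g (e q) * h (e p)))"
proof -
  have "\<rho> g i * \<rho> h k - \<rho> g k * \<rho> h i = (\<Sum>p=1..n. \<Sum>q=1..n. D i k p q * (g (e p) * h (e q)))"
  proof -
    have "\<rho> g' i' * \<rho> h' k' = (\<Sum>p=1..n. \<Sum>q=1..n. (a i' p * a k' q) * (g' (e p) * h' (e q)))"
      for g' h' i' k'
      by (simp only: \<rho>_def sum_product) (simp add: ac_simps)
    then show ?thesis
      by (simp add: D_def left_diff_distrib sum_subtractf)
  qed
  also have "\<dots> = (\<Sum>p=1..n. \<Sum>q=Suc p..n. D i k p q * (g (e p) * h (e q)) + D i k q p * (g (e q) * h (e p)))"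
    by (rule sum_off_diagonal) (simp add: D_def)
  also have "\<dots> = (\<Sum>p=1..n. \<Sum>q=Suc p..n. D i k p q * (g (e p) * h (e q) - g (e q) * h (e p)))"
    by (simp add: D_def algebra_simps)
  finally show ?thesis .
qed

text \<open>Exchanging \<open>i\<close> and \<open>k\<close> changes the sign of the bracket, so the
  double sum over the coordinates of \<open>R g\<close> and \<open>R h\<close> folds into two-by-two
  minors, to which \<open>minor_\<rho>\<close> applies.\<close>

lemma dual_br_R:
  assumes "f \<in> dual s"
  shows "f (br x (R g) (R h)) = (\<Sum>i=1..n. \<Sum>k=Suc i..n. \<Sum>p=1..n. \<Sum>q=Suc p..n.
    D i k p q * (f (br x (e i) (e k)) * (g (e p) * h (e q) - g (e q) * h (e p))))"
proof -
  have "f (br x (R g) (R h)) = (\<Sum>i=1..n. \<Sum>k=1..n. \<rho> g i * \<rho> h k * f (br x (e i) (e k)))"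
    by (subst dual_R[OF br_dual(2)[OF assms]])
      (simp add: dual_R[OF br_dual(3)[OF assms]] sum_distrib_left mult.assoc)
  also have "\<dots> = (\<Sum>i=1..n. \<Sum>k=Suc i..n. \<rho> g i * \<rho> h k * f (br x (e i) (e k)) + \<rho> g k * \<rho> h i * f (br x (e k) (e i)))"
    by (intro sum_off_diagonal) (simp add: br_alternating dual_zero[OF assms])
  also have "\<dots> = (\<Sum>i=1..n. \<Sum>k=Suc i..n. (\<rho> g i * \<rho> h k - \<rho> g k * \<rho> h i) * f (br x (e i) (e k)))"
  proof (intro sum.cong refl)
    fix i k
    show "\<rho> g i * \<rho> h k * f (br x (e i) (e k)) + \<rho> g k * \<rho> h i * f (br x (e k) (e i)) =
        (\<rho> g i * \<rho> h k - \<rho> g k * \<rho> h i) * f (br x (e i) (e k))"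
      using assms br_skew(2)[of x "e i" "e k"] by (simp add: dual_uminus algebra_simps)
  qed
  finally show ?thesis
    by (simp only: minor_\<rho> sum_distrib_right) (simp add: ac_simps)
qed

text \<open>The three cyclic terms of the dual bracket, expanded by \<open>dual_br_R\<close>, group
  the six terms of the wedge by the functional that meets its first vector.\<close>

lemma \<Delta>r_eq:
  "\<Delta>r x = (\<Sum>i=1..n. \<Sum>k=Suc i..n. \<Sum>p=1..n. \<Sum>q=Suc p..n.
    D i k p q *\<^sub>C wedge s [br x (e i) (e k), e p, e q])" (is "_ = ?r")
proof (rule tensor3_eqI[of s])
  fix fs :: "('a \<Rightarrow> complex) list" assume fs: "length fs \<noteq> 3 \<or> \<not> set fs \<subseteq> dual s"
  then have "pure_tensor s [u, v, w] fs = 0" for u v w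
    by (auto simp: pure_tensor_def)
  with fs show "\<Delta>r x fs = ?r fs"
    by (simp add: \<Delta>r_def \<Delta>1_def \<Delta>2_def \<Delta>3_def sum_list_fun_apply case_prod_unfold sum_fun_apply
        wedge3_outside fscale_def)
next
  fix f g h assume d: "f \<in> dual s" "g \<in> dual s" "h \<in> dual s"
  have "\<Delta>r x [f, g, h] = f (br x (R g) (R h)) + g (br x (R h) (R f)) + h (br x (R f) (R g))"
    using fun_cong[OF dual_bracket_\<Delta>r[OF d], of x] by (simp add: dual_bracket_def)
  also have "\<dots> = ?r [f, g, h]"
    unfolding dual_br_R[OF d(1)] dual_br_R[OF d(2)] dual_br_R[OF d(3)]
    by (simp add: sum_fun_apply fscale_def wedge3_apply d algebra_simps flip: sum.distrib)
  finally show "\<Delta>r x [f, g, h] = ?r [f, g, h]" .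
qed

text \<open>A linear map is determined by its values on a basis, so the two maps are equal.\<close>

lemma local_cocycle_bialgebraI:
  assumes "lin_on s UNIV fscale (tensor_power s 3) \<Delta>"
    and "\<And>m. m \<in> {1..n} \<Longrightarrow> \<Delta> (e m) = \<Delta>r (e m)"
  shows "local_cocycle_bialgebra s br \<Delta>"
proof -
  interpret F: vector_space "fscale :: complex \<Rightarrow> 'a tensor \<Rightarrow> 'a tensor"
    by (rule vector_space_fscale)
  interpret P: vector_space_pair s "fscale :: complex \<Rightarrow> 'a tensor \<Rightarrow> 'a tensor"
    by unfold_locales
  have "\<Delta> x = \<Delta>r x" for x
  proof (rule P.linear_eq_on[of _ _ _ "e ` {1..n}"])
    show "Vector_Spaces.linear s fscale \<Delta>" "Vector_Spaces.linear s fscale \<Delta>r"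
      using assms(1) lin_on_\<Delta>r by (auto simp: Vector_Spaces.linear_iff lin_on_def vector_space_axioms F.vector_space_axioms)
    show "x \<in> span (e ` {1..n})" using basis by (simp add: is_basis_def)
  qed (use assms(2) in auto)
  then have "\<Delta> = \<Delta>r" ..
  then show ?thesis using local_cocycle_bialgebra_\<Delta>r by simp
qed

lemma dual_basis_exists:
  assumes "j \<in> {1..n}"
  obtains f where "f \<in> dual s" "\<And>i. i \<in> {1..n} \<Longrightarrow> f (e i) = (if i = j then 1 else 0)"
proof -
  interpret C: vector_space "(*) :: complex \<Rightarrow> complex \<Rightarrow> complex"
    by unfold_locales (auto simp: algebra_simps)
  interpret P: vector_space_pair s "(*) :: complex \<Rightarrow> complex \<Rightarrow> complex"
    by unfold_locales
  have ind: "independent (e ` {1..n})" and inj: "inj_on e {1..n}"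
    using basis by (auto simp: is_basis_def)
  obtain f where f: "Vector_Spaces.linear s (*) f" "\<forall>x\<in>e ` {1..n}. f x = (if x = e j then 1 else 0)"
    using P.linear_independent_extend[OF ind, of "\<lambda>x. if x = e j then 1 else 0"] by blast
  show thesis
  proof (rule that)
    show "f \<in> dual s" using f(1) by (simp add: dual_def)
    show "f (e i) = (if i = j then 1 else 0)" if "i \<in> {1..n}" for i
      using f(2) inj that assms by (auto dest: inj_onD)
  qed
qed

text \<open>The inner sum of \<open>\<Delta>r_eq\<close> with a free vector in place of the bracket;
  by linearity in that vector, structure constants can be inserted before the wedges are
  expanded.\<close>

definition S :: "'a \<Rightarrow> nat \<Rightarrow> nat \<Rightarrow> 'a tensor"
  where "S v i k = (\<Sum>p=1..n. \<Sum>q=Suc p..n. D i k p q *\<^sub>C wedge s [v, e p, e q])"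

lemma S_linear: "S (u + v) i k = S u i k + S v i k" "S (s c v) i k = c *\<^sub>C S v i k"
  "S (- v) i k = - S v i k" "S 0 i k = 0"
  by (simp_all add: S_def wedge3_linear wedge3_uminus[OF vector_space_axioms]
      wedge3_zero[OF vector_space_axioms] fun_eq_iff fscale_def sum_fun_apply algebra_simps
      sum.distrib sum_negf sum_distrib_left)

lemma \<Delta>r_S: "\<Delta>r x = (\<Sum>i=1..n. \<Sum>k=Suc i..n. S (br x (e i) (e k)) i k)"
  by (simp add: \<Delta>r_eq S_def)

end

section \<open>Dimensions three and four\<close>

lemma sum_pairs3:
  "(\<Sum>i=1..3. \<Sum>k=Suc i..3. T i k) = T 1 2 + T 1 3 + T 2 (3::nat)"
  by (simp add: eval_nat_numeral)

lemma sum_pairs4: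
  "(\<Sum>i=1..4. \<Sum>k=Suc i..4. T i k) = T 1 2 + T 1 3 + T 1 4 + T 2 3 + T 2 4 + T 3 (4::nat)"
  by (simp add: eval_nat_numeral add.assoc)

locale skew_YB_matrix3 = skew_YB_matrix s br 3 e a
  for s :: "complex \<Rightarrow> 'a::ab_group_add \<Rightarrow> 'a" and br e a
begin

lemma a_simps: "a 1 1 = 0" "a 2 2 = 0" "a 3 3 = 0" "a 2 1 = - a 1 2" "a 3 1 = - a 1 3" "a 3 2 = - a 2 3"
  using a_skew[of 1 1] a_skew[of 2 2] a_skew[of 3 3] a_skew[of 2 1] a_skew[of 3 1] a_skew[of 3 2] by simp_all

lemma S_expand:
  "S v i k = D i k 1 2 *\<^sub>C wedge s [v, e 1, e 2] + D i k 1 3 *\<^sub>C wedge s [v, e 1, e 3] +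
    D i k 2 3 *\<^sub>C wedge s [v, e 2, e 3]"
  by (simp only: S_def sum_pairs3)

text \<open>At \<open>e m\<close> only the pair avoiding \<open>m\<close> survives, since the
  bracket alternates; moving \<open>e m\<close> into increasing position produces the signs.\<close>

lemma local_cocycle_bialgebra3I:
  assumes "lin_on s UNIV fscale (tensor_power s 3) \<Delta>"
    and "\<Delta> (e 1) = S (br (e 1) (e 2) (e 3)) 2 3"
    and "\<Delta> (e 2) = - S (br (e 1) (e 2) (e 3)) 1 3"
    and "\<Delta> (e 3) = S (br (e 1) (e 2) (e 3)) 1 2"
  shows "local_cocycle_bialgebra s br \<Delta>"
proof (rule local_cocycle_bialgebraI[OF assms(1)])
  fix m :: nat assume "m \<in> {1..3}"
  then consider "m = 1" | "m = 2" | "m = 3" by force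
  then show "\<Delta> (e m) = \<Delta>r (e m)"
    unfolding \<Delta>r_S sum_pairs3
    by cases (simp_all only: assms br_alternating S_linear br_skew(1)[of "e 1" "e 2"]
        br_cycle[of "e 1" "e 2" "e 3", symmetric] add_0_left add_0_right minus_minus br_cycle[of "e 2" "e 3" "e 1", symmetric])
qed

end

locale skew_YB_matrix4 = skew_YB_matrix s br 4 e a
  for s :: "complex \<Rightarrow> 'a::ab_group_add \<Rightarrow> 'a" and br e a
begin

lemma a_simps: "a 1 1 = 0" "a 2 2 = 0" "a 3 3 = 0" "a 4 4 = 0"
  "a 2 1 = - a 1 2" "a 3 1 = - a 1 3" "a 3 2 = - a 2 3"
  "a 4 1 = - a 1 4" "a 4 2 = - a 2 4" "a 4 3 = - a 3 4"
  using a_skew[of 1 1] a_skew[of 2 2] a_skew[of 3 3] a_skew[of 4 4]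
    a_skew[of 2 1] a_skew[of 3 1] a_skew[of 3 2] a_skew[of 4 1] a_skew[of 4 2] a_skew[of 4 3] by simp_all

lemma br_sort:
  "br (e 2) (e 1) x = - br (e 1) (e 2) x" "br (e 3) (e 1) x = - br (e 1) (e 3) x"
  "br (e 3) (e 2) x = - br (e 2) (e 3) x" "br (e 4) (e 1) x = - br (e 1) (e 4) x"
  "br (e 4) (e 2) x = - br (e 2) (e 4) x" "br (e 4) (e 3) x = - br (e 3) (e 4) x"
  "br x (e 2) (e 1) = - br x (e 1) (e 2)" "br x (e 3) (e 1) = - br x (e 1) (e 3)"
  "br x (e 3) (e 2) = - br x (e 2) (e 3)" "br x (e 4) (e 1) = - br x (e 1) (e 4)"
  "br x (e 4) (e 2) = - br x (e 2) (e 4)" "br x (e 4) (e 3) = - br x (e 3) (e 4)"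
  by (rule br_skew)+

lemma wedge_sort:
  "wedge s [e 2, e 1, x] = - wedge s [e 1, e 2, x]" "wedge s [e 3, e 1, x] = - wedge s [e 1, e 3, x]"
  "wedge s [e 3, e 2, x] = - wedge s [e 2, e 3, x]" "wedge s [e 4, e 1, x] = - wedge s [e 1, e 4, x]"
  "wedge s [e 4, e 2, x] = - wedge s [e 2, e 4, x]" "wedge s [e 4, e 3, x] = - wedge s [e 3, e 4, x]"
  "wedge s [x, e 2, e 1] = - wedge s [x, e 1, e 2]" "wedge s [x, e 3, e 1] = - wedge s [x, e 1, e 3]"
  "wedge s [x, e 3, e 2] = - wedge s [x, e 2, e 3]" "wedge s [x, e 4, e 1] = - wedge s [x, e 1, e 4]"
  "wedge s [x, e 4, e 2] = - wedge s [x, e 2, e 4]" "wedge s [x, e 4, e 3] = - wedge s [x, e 3, e 4]"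
  by (rule wedge3_skew)+

lemma S_expand:
  "S v i k = D i k 1 2 *\<^sub>C wedge s [v, e 1, e 2] + D i k 1 3 *\<^sub>C wedge s [v, e 1, e 3] +
    D i k 1 4 *\<^sub>C wedge s [v, e 1, e 4] + D i k 2 3 *\<^sub>C wedge s [v, e 2, e 3] +
    D i k 2 4 *\<^sub>C wedge s [v, e 2, e 4] + D i k 3 4 *\<^sub>C wedge s [v, e 3, e 4]"
  by (simp only: S_def sum_pairs4)

text \<open>At \<open>e m\<close> the three pairs avoiding \<open>m\<close> survive, with signs from
  sorting the arguments of the bracket.\<close>

lemma local_cocycle_bialgebra4I:
  assumes "lin_on s UNIV fscale (tensor_power s 3) \<Delta>"
    and "\<Delta> (e 1) = S (br (e 1) (e 2) (e 3)) 2 3 + S (br (e 1) (e 2) (e 4)) 2 4 + S (br (e 1) (e 3) (e 4)) 3 4"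
    and "\<Delta> (e 2) = - S (br (e 1) (e 2) (e 3)) 1 3 - S (br (e 1) (e 2) (e 4)) 1 4 + S (br (e 2) (e 3) (e 4)) 3 4"
    and "\<Delta> (e 3) = S (br (e 1) (e 2) (e 3)) 1 2 - S (br (e 1) (e 3) (e 4)) 1 4 - S (br (e 2) (e 3) (e 4)) 2 4"
    and "\<Delta> (e 4) = S (br (e 1) (e 2) (e 4)) 1 2 + S (br (e 1) (e 3) (e 4)) 1 3 + S (br (e 2) (e 3) (e 4)) 2 3"
  shows "local_cocycle_bialgebra s br \<Delta>"
proof (rule local_cocycle_bialgebraI[OF assms(1)])
  fix m :: nat assume "m \<in> {1..4}"
  then consider "m = 1" | "m = 2" | "m = 3" | "m = 4" by force
  then show "\<Delta> (e m) = \<Delta>r (e m)"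
    unfolding \<Delta>r_S sum_pairs4
    by cases (simp_all only: assms br_alternating br_uminus br_sort S_linear, simp_all)
qed

text \<open>By skew-symmetry, each bracket of basis vectors is multiplied by a three-by-three minor
  of the coordinates, expanded along the first argument.\<close>

lemma dual_br_expand:
  assumes "f \<in> dual s"
  shows "f (br (s u1 (e 1) + s u2 (e 2) + s u3 (e 3) + s u4 (e 4))
      (s v1 (e 1) + s v2 (e 2) + s v3 (e 3) + s v4 (e 4))
      (s w1 (e 1) + s w2 (e 2) + s w3 (e 3) + s w4 (e 4))) =
    (u1 * (v2 * w3 - v3 * w2) - u2 * (v1 * w3 - v3 * w1) + u3 * (v1 * w2 - v2 * w1)) * f (br (e 1) (e 2) (e 3)) +
    (u1 * (v2 * w4 - v4 * w2) - u2 * (v1 * w4 - v4 * w1) + u4 * (v1 * w2 - v2 * w1)) * f (br (e 1) (e 2) (e 4)) +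
    (u1 * (v3 * w4 - v4 * w3) - u3 * (v1 * w4 - v4 * w1) + u4 * (v1 * w3 - v3 * w1)) * f (br (e 1) (e 3) (e 4)) +
    (u2 * (v3 * w4 - v4 * w3) - u3 * (v2 * w4 - v4 * w2) + u4 * (v2 * w3 - v3 * w2)) * f (br (e 2) (e 3) (e 4))"
proof -
  have f: "f (x + y) = f x + f y" "f (s c x) = c * f x" "f (- x) = - f x" "f 0 = 0" for x y c
    using assms by (simp_all add: dual_uminus dual_zero) (simp_all add: dual_iff)
  show ?thesis
    by (simp only: br_linear br_sort br_alternating f) (simp add: algebra_simps del: One_nat_def)
qed

text \<open>Along with the dual basis, this records that \<open>R\<close> sends its
  \<open>j\<close>-th element to the \<open>j\<close>-th column of \<open>a\<close>.\<close>

lemma dual_basis4: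
  obtains f1 f2 f3 f4 where
    "f1 \<in> dual s" "f2 \<in> dual s" "f3 \<in> dual s" "f4 \<in> dual s"
    "f1 (e 1) = 1" "f1 (e 2) = 0" "f1 (e 3) = 0" "f1 (e 4) = 0"
    "f2 (e 1) = 0" "f2 (e 2) = 1" "f2 (e 3) = 0" "f2 (e 4) = 0"
    "f3 (e 1) = 0" "f3 (e 2) = 0" "f3 (e 3) = 1" "f3 (e 4) = 0"
    "f4 (e 1) = 0" "f4 (e 2) = 0" "f4 (e 3) = 0" "f4 (e 4) = 1"
    "R f1 = s (a 1 1) (e 1) + s (a 2 1) (e 2) + s (a 3 1) (e 3) + s (a 4 1) (e 4)"
      "R f2 = s (a 1 2) (e 1) + s (a 2 2) (e 2) + s (a 3 2) (e 3) + s (a 4 2) (e 4)"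
      "R f3 = s (a 1 3) (e 1) + s (a 2 3) (e 2) + s (a 3 3) (e 3) + s (a 4 3) (e 4)"
      "R f4 = s (a 1 4) (e 1) + s (a 2 4) (e 2) + s (a 3 4) (e 3) + s (a 4 4) (e 4)"
proof -
  have sum4: "sum T {1..4} = T 1 + T 2 + T 3 + T (4::nat)" for T :: "nat \<Rightarrow> 'b::comm_monoid_add"
    by (simp add: eval_nat_numeral)
  have "\<forall>j\<in>{1..4}. \<exists>f. f \<in> dual s \<and> (\<forall>i\<in>{1..4}. f (e i) = (if i = j then 1 else 0))"
    by (metis dual_basis_exists)
  then obtain f where f: "\<And>j. j \<in> {1..4} \<Longrightarrow> f j \<in> dual s"
      "\<And>i j. i \<in> {1..4} \<Longrightarrow> j \<in> {1..4} \<Longrightarrow> f j (e i) = (if i = j then 1 else 0)"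
    by metis
  have "R (f j) = s (a 1 j) (e 1) + s (a 2 j) (e 2) + s (a 3 j) (e 3) + s (a 4 j) (e 4)"
    if "j \<in> {1..4}" for j
  proof -
    have "\<rho> (f j) i = a i j" for i
      unfolding \<rho>_def using that by (simp add: f(2) if_distrib cong: if_cong)
    then show ?thesis unfolding R_eq sum4 by simp
  qed
  then show thesis
    by (intro that[of "f 1" "f 2" "f 3" "f 4"]) (simp_all add: f del: One_nat_def)
qed

text \<open>The determinant of rows \<open>i\<close>, \<open>j\<close>, \<open>k\<close> and columns
  \<open>p\<close>, \<open>q\<close>, \<open>r\<close> of \<open>a\<close>, expanded along column
  \<open>p\<close> as in \<open>dual_br_expand\<close>.\<close>

definition minor :: "nat \<Rightarrow> nat \<Rightarrow> nat \<Rightarrow> nat \<Rightarrow> nat \<Rightarrow> nat \<Rightarrow> complex"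
  where "minor i j k p q r = a i p * (a j q * a k r - a k q * a j r) -
    a j p * (a i q * a k r - a k q * a i r) + a k p * (a i q * a j r - a j q * a i r)"

text \<open>The component of the Yang-Baxter equation at \<open>e\<^sub>1 \<otimes> e\<^sub>2 \<otimes> e\<^sub>3 \<otimes> e\<^sub>4\<close>.\<close>

lemma YB_component:
  fixes c123 c124 c134 c234 :: "nat \<Rightarrow> complex"
  assumes "br (e 1) (e 2) (e 3) = s (c123 1) (e 1) + s (c123 2) (e 2) + s (c123 3) (e 3) + s (c123 4) (e 4)"
    and "br (e 1) (e 2) (e 4) = s (c124 1) (e 1) + s (c124 2) (e 2) + s (c124 3) (e 3) + s (c124 4) (e 4)"
    and "br (e 1) (e 3) (e 4) = s (c134 1) (e 1) + s (c134 2) (e 2) + s (c134 3) (e 3) + s (c134 4) (e 4)"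
    and "br (e 2) (e 3) (e 4) = s (c234 1) (e 1) + s (c234 2) (e 2) + s (c234 3) (e 3) + s (c234 4) (e 4)"
  shows "(minor 1 2 3 2 3 4 * c123 1 + minor 1 2 4 2 3 4 * c124 1 + minor 1 3 4 2 3 4 * c134 1 + minor 2 3 4 2 3 4 * c234 1) -
    (minor 1 2 3 1 3 4 * c123 2 + minor 1 2 4 1 3 4 * c124 2 + minor 1 3 4 1 3 4 * c134 2 + minor 2 3 4 1 3 4 * c234 2) +
    (minor 1 2 3 1 2 4 * c123 3 + minor 1 2 4 1 2 4 * c124 3 + minor 1 3 4 1 2 4 * c134 3 + minor 2 3 4 1 2 4 * c234 3) -
    (minor 1 2 3 1 2 3 * c123 4 + minor 1 2 4 1 2 3 * c124 4 + minor 1 3 4 1 2 3 * c134 4 + minor 2 3 4 1 2 3 * c234 4) = 0"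
proof -
  obtain f1 f2 f3 f4 where d: "f1 \<in> dual s" "f2 \<in> dual s" "f3 \<in> dual s" "f4 \<in> dual s"
    and f: "f1 (e 1) = 1" "f1 (e 2) = 0" "f1 (e 3) = 0" "f1 (e 4) = 0"
      "f2 (e 1) = 0" "f2 (e 2) = 1" "f2 (e 3) = 0" "f2 (e 4) = 0"
      "f3 (e 1) = 0" "f3 (e 2) = 0" "f3 (e 3) = 1" "f3 (e 4) = 0"
      "f4 (e 1) = 0" "f4 (e 2) = 0" "f4 (e 3) = 0" "f4 (e 4) = 1"
    and R: "R f1 = s (a 1 1) (e 1) + s (a 2 1) (e 2) + s (a 3 1) (e 3) + s (a 4 1) (e 4)"
      "R f2 = s (a 1 2) (e 1) + s (a 2 2) (e 2) + s (a 3 2) (e 3) + s (a 4 2) (e 4)"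
      "R f3 = s (a 1 3) (e 1) + s (a 2 3) (e 2) + s (a 3 3) (e 3) + s (a 4 3) (e 4)"
      "R f4 = s (a 1 4) (e 1) + s (a 2 4) (e 2) + s (a 3 4) (e 3) + s (a 4 4) (e 4)"
    by (rule dual_basis4)
  have lin: "f (x + y) = f x + f y" "f (s c x) = c * f x" if "f \<in> dual s" for f c x y
    using that by (simp_all add: dual_iff)
  \<comment> \<open>The dual basis picks out the structure constants, and its images under
    \<open>R\<close> are the columns of \<open>a\<close>, so the coefficients from
    \<open>dual_br_expand\<close> are the minors.\<close>
  show ?thesis
    using YB_R[OF d]
    unfolding R dual_br_expand[OF d(1)] dual_br_expand[OF d(2)] dual_br_expand[OF d(3)]
      dual_br_expand[OF d(4)] assms lin[OF d(1)] lin[OF d(2)] lin[OF d(3)] lin[OF d(4)] f minor_def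
    by (simp del: One_nat_def)
qed

end

section \<open>The eight families\<close>

theorem proposition3p10:
  fixes s :: "complex \<Rightarrow> 'a::ab_group_add \<Rightarrow> 'a"
    and br :: "'a \<Rightarrow> 'a \<Rightarrow> 'a \<Rightarrow> 'a"
    and n :: nat and e :: "nat \<Rightarrow> 'a"
    and a :: "nat \<Rightarrow> nat \<Rightarrow> complex" and \<alpha> :: complex
    and r :: "'a tensor" and \<Delta> :: "'a \<Rightarrow> 'a tensor"
    and D :: "nat \<Rightarrow> nat \<Rightarrow> nat \<Rightarrow> nat \<Rightarrow> complex"
    and E :: "nat \<Rightarrow> nat \<Rightarrow> nat \<Rightarrow> 'a tensor"
  assumes A: "three_Lie_algebra s UNIV br"
    and basis: "is_basis s e n"
    and D: "\<And>i j p q. D i j p q = a i p * a j q - a j p * a i q"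
    and E: "\<And>i j k. E i j k = wedge s [e i, e j, e k]"
    and r: "r = (\<Sum>i=1..n. \<Sum>j=1..n. a i j *\<^sub>C pure_tensor s [e i, e j])"
    and skew: "\<And>i j. i \<in> {1..n} \<Longrightarrow> j \<in> {1..n} \<Longrightarrow> a i j = - a j i"
    and CYBE: "YB_bracket s br r = 0"
    and \<Delta>: "lin_on s UNIV fscale (tensor_power s 3) \<Delta>"
  shows "(n = 3 \<and> br (e 1) (e 2) (e 3) = e 1 \<and>
      \<Delta> (e 1) = D 2 3 2 3 *\<^sub>C E 1 2 3 \<and>
      \<Delta> (e 2) = (- D 1 3 2 3) *\<^sub>C E 1 2 3 \<and>
      \<Delta> (e 3) = D 1 2 2 3 *\<^sub>C E 1 2 3
     \<longrightarrow> local_cocycle_bialgebra s br \<Delta>) \<and>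
    (n = 4 \<and> br (e 1) (e 2) (e 3) = e 4 \<and> br (e 1) (e 2) (e 4) = e 3 \<and> br (e 1) (e 3) (e 4) = e 2 \<and> br (e 2) (e 3) (e 4) = e 1 \<and>
      \<Delta> (e 1) = (D 3 4 3 4 - D 2 4 2 4 + D 2 3 2 3) *\<^sub>C E 2 3 4 + (D 2 4 1 2 - D 3 4 1 3) *\<^sub>C E 1 2 3 + (D 2 3 1 2 - D 3 4 1 4) *\<^sub>C E 1 2 4 + (D 2 3 1 3 - D 2 4 1 4) *\<^sub>C E 1 3 4 \<and>
      \<Delta> (e 2) = (D 3 4 3 4 - D 1 3 1 3 + D 1 4 1 4) *\<^sub>C E 1 3 4 + (D 3 4 2 3 - D 1 4 1 2) *\<^sub>C E 1 2 3 + (D 3 4 2 4 - D 1 3 1 2) *\<^sub>C E 1 2 4 + (D 1 4 2 4 - D 1 3 2 3) *\<^sub>C E 2 3 4 \<and>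
      \<Delta> (e 3) = (D 1 2 1 2 - D 2 4 2 4 + D 1 4 1 4) *\<^sub>C E 1 2 4 + (D 1 4 1 3 - D 2 4 2 3) *\<^sub>C E 1 2 3 + (D 1 2 1 3 - D 2 4 3 4) *\<^sub>C E 1 3 4 + (D 1 2 2 3 - D 1 4 3 4) *\<^sub>C E 2 3 4 \<and>
      \<Delta> (e 4) = (D 1 2 1 2 - D 1 3 1 3 + D 2 3 2 3) *\<^sub>C E 1 2 3 + (D 2 3 2 4 - D 1 3 1 4) *\<^sub>C E 1 2 4 + (D 2 3 3 4 - D 1 2 1 4) *\<^sub>C E 1 3 4 + (D 1 3 3 4 - D 1 2 2 4) *\<^sub>C E 2 3 4
     \<longrightarrow> local_cocycle_bialgebra s br \<Delta>) \<and>
    (n = 4 \<and> br (e 1) (e 2) (e 3) = e 1 \<and> br (e 1) (e 2) (e 4) = 0 \<and> br (e 1) (e 3) (e 4) = 0 \<and> br (e 2) (e 3) (e 4) = 0 \<and>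
      \<Delta> (e 1) = D 2 3 2 3 *\<^sub>C E 1 2 3 + D 2 3 2 4 *\<^sub>C E 1 2 4 + D 2 3 3 4 *\<^sub>C E 1 3 4 \<and>
      \<Delta> (e 2) = (- D 1 3 2 3) *\<^sub>C E 1 2 3 - D 1 3 2 4 *\<^sub>C E 1 2 4 - D 1 3 3 4 *\<^sub>C E 1 3 4 \<and>
      \<Delta> (e 3) = D 1 2 2 3 *\<^sub>C E 1 2 3 + D 1 2 2 4 *\<^sub>C E 1 2 4 + D 1 2 3 4 *\<^sub>C E 1 3 4 \<and>
      \<Delta> (e 4) = 0
     \<longrightarrow> local_cocycle_bialgebra s br \<Delta> \<and>
       a 2 3 * (a 1 2 * a 3 4 - a 1 3 * a 2 4 - a 3 2 * a 1 4) = 0) \<and>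
    (n = 4 \<and> br (e 1) (e 2) (e 3) = 0 \<and> br (e 1) (e 2) (e 4) = 0 \<and> br (e 1) (e 3) (e 4) = 0 \<and> br (e 2) (e 3) (e 4) = e 1 \<and>
      \<Delta> (e 1) = 0 \<and>
      \<Delta> (e 2) = D 3 4 2 3 *\<^sub>C E 1 2 3 + D 3 4 2 4 *\<^sub>C E 1 2 4 + D 3 4 3 4 *\<^sub>C E 1 3 4 \<and>
      \<Delta> (e 3) = (- D 2 4 2 3) *\<^sub>C E 1 2 3 - D 2 4 2 4 *\<^sub>C E 1 2 4 - D 2 4 3 4 *\<^sub>C E 1 3 4 \<and>
      \<Delta> (e 4) = D 2 3 2 3 *\<^sub>C E 1 2 3 + D 2 3 2 4 *\<^sub>C E 1 2 4 + D 2 3 3 4 *\<^sub>C E 1 3 4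
     \<longrightarrow> local_cocycle_bialgebra s br \<Delta>) \<and>
    (n = 4 \<and> br (e 1) (e 2) (e 3) = 0 \<and> br (e 1) (e 2) (e 4) = 0 \<and> br (e 1) (e 3) (e 4) = e 2 \<and> br (e 2) (e 3) (e 4) = e 1 \<and>
      \<Delta> (e 1) = (- D 3 4 1 3) *\<^sub>C E 1 2 3 - D 3 4 1 4 *\<^sub>C E 1 2 4 + D 3 4 3 4 *\<^sub>C E 2 3 4 \<and>
      \<Delta> (e 2) = D 3 4 2 3 *\<^sub>C E 1 2 3 + D 3 4 2 4 *\<^sub>C E 1 2 4 + D 3 4 3 4 *\<^sub>C E 1 3 4 \<and>
      \<Delta> (e 3) = (D 1 4 1 3 - D 2 4 2 3) *\<^sub>C E 1 2 3 + (D 1 4 1 4 - D 2 4 2 4) *\<^sub>C E 1 2 4 - D 2 4 3 4 *\<^sub>C E 1 3 4 - D 1 4 3 4 *\<^sub>C E 2 3 4 \<and>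
      \<Delta> (e 4) = (D 2 3 2 3 - D 1 3 1 3) *\<^sub>C E 1 2 3 + (D 2 3 2 4 - D 1 3 1 4) *\<^sub>C E 1 2 4 + D 2 3 3 4 *\<^sub>C E 1 3 4 + D 1 3 3 4 *\<^sub>C E 2 3 4
     \<longrightarrow> local_cocycle_bialgebra s br \<Delta>) \<and>
    (n = 4 \<and> br (e 1) (e 2) (e 3) = 0 \<and> br (e 1) (e 2) (e 4) = 0 \<and> br (e 1) (e 3) (e 4) = e 1 \<and> br (e 2) (e 3) (e 4) = e 2 \<and>
      \<Delta> (e 1) = D 3 4 2 3 *\<^sub>C E 1 2 3 + D 3 4 2 4 *\<^sub>C E 1 2 4 + D 3 4 3 4 *\<^sub>C E 1 3 4 \<and>
      \<Delta> (e 2) = (- D 3 4 1 3) *\<^sub>C E 1 2 3 - D 3 4 1 4 *\<^sub>C E 1 2 4 + D 3 4 3 4 *\<^sub>C E 2 3 4 \<and>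
      \<Delta> (e 3) = (D 2 4 1 3 - D 1 4 2 3) *\<^sub>C E 1 2 3 + (D 2 4 1 4 - D 1 4 2 4) *\<^sub>C E 1 2 4 - D 1 4 3 4 *\<^sub>C E 1 3 4 - D 2 4 3 4 *\<^sub>C E 2 3 4 \<and>
      \<Delta> (e 4) = (D 1 3 2 3 - D 2 3 1 3) *\<^sub>C E 1 2 3 + (D 1 3 2 4 - D 2 3 1 4) *\<^sub>C E 1 2 4 + D 1 3 3 4 *\<^sub>C E 1 3 4 + D 2 3 3 4 *\<^sub>C E 2 3 4
     \<longrightarrow> local_cocycle_bialgebra s br \<Delta> \<and>
       a 3 4 * (a 1 2 * a 3 4 - a 3 2 * a 1 4 + a 4 2 * a 1 3) = 0) \<and>
    (n = 4 \<and> \<alpha> \<noteq> 0 \<and> br (e 1) (e 2) (e 3) = 0 \<and> br (e 1) (e 2) (e 4) = 0 \<and> br (e 1) (e 3) (e 4) = e 2 \<and> br (e 2) (e 3) (e 4) = s \<alpha> (e 1) + e 2 \<and>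
      \<Delta> (e 1) = (- D 3 4 1 3) *\<^sub>C E 1 2 3 - D 3 4 1 4 *\<^sub>C E 1 2 4 + D 3 4 3 4 *\<^sub>C E 2 3 4 \<and>
      \<Delta> (e 2) = (\<alpha> * D 3 4 2 3 - D 3 4 1 3) *\<^sub>C E 1 2 3 + (\<alpha> * D 3 4 2 4 - D 3 4 1 4) *\<^sub>C E 1 2 4 + (\<alpha> * D 3 4 3 4) *\<^sub>C E 1 3 4 + D 3 4 3 4 *\<^sub>C E 2 3 4 \<and>
      \<Delta> (e 3) = (D 2 4 1 3 + D 1 4 1 3 - \<alpha> * D 2 4 2 3) *\<^sub>C E 1 2 3 + (D 2 4 1 4 + D 1 4 1 4 - \<alpha> * D 2 4 2 4) *\<^sub>C E 1 2 4 - (\<alpha> * D 2 4 3 4) *\<^sub>C E 1 3 4 - (D 2 4 3 4 + D 1 4 3 4) *\<^sub>C E 2 3 4 \<and>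
      \<Delta> (e 4) = (\<alpha> * D 2 3 2 3 - D 2 3 1 3 - D 1 3 1 3) *\<^sub>C E 1 2 3 + (\<alpha> * D 2 3 2 4 - D 2 3 1 4 - D 1 3 1 4) *\<^sub>C E 1 2 4 + (\<alpha> * D 2 3 3 4) *\<^sub>C E 1 3 4 + (D 2 3 3 4 + D 1 3 3 4) *\<^sub>C E 2 3 4
     \<longrightarrow> local_cocycle_bialgebra s br \<Delta> \<and>
       a 3 4 * (a 1 2 * a 4 3 + a 3 2 * a 1 4 - a 4 2 * a 1 3) = 0) \<and>
    (n = 4 \<and> br (e 1) (e 2) (e 3) = 0 \<and> br (e 1) (e 2) (e 4) = e 3 \<and> br (e 1) (e 3) (e 4) = e 2 \<and> br (e 2) (e 3) (e 4) = e 1 \<and>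
      \<Delta> (e 1) = (D 2 4 1 2 - D 3 4 1 3) *\<^sub>C E 1 2 3 + D 3 4 4 1 *\<^sub>C E 1 2 4 - D 2 4 1 4 *\<^sub>C E 1 3 4 + (D 3 4 3 4 - D 2 4 2 4) *\<^sub>C E 2 3 4 \<and>
      \<Delta> (e 2) = (D 3 4 2 3 - D 1 4 1 2) *\<^sub>C E 1 2 3 + D 3 4 2 4 *\<^sub>C E 1 2 4 + (D 3 4 3 4 + D 1 4 1 4) *\<^sub>C E 1 3 4 + D 1 4 2 4 *\<^sub>C E 2 3 4 \<and>
      \<Delta> (e 3) = (D 1 4 1 3 - D 2 4 2 3) *\<^sub>C E 1 2 3 + (D 1 4 1 4 - D 2 4 2 4) *\<^sub>C E 1 2 4 - D 2 4 3 4 *\<^sub>C E 1 3 4 - D 1 4 3 4 *\<^sub>C E 2 3 4 \<and>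
      \<Delta> (e 4) = (D 1 2 1 2 - D 1 3 1 3 + D 2 3 2 3) *\<^sub>C E 1 2 3 + (D 2 3 2 4 - D 1 3 1 4) *\<^sub>C E 1 2 4 + (D 2 3 3 4 - D 1 2 1 4) *\<^sub>C E 1 3 4 + (D 1 3 3 4 - D 1 2 2 4) *\<^sub>C E 2 3 4
     \<longrightarrow> local_cocycle_bialgebra s br \<Delta>)"

proof -
  have M: "skew_YB_matrix s br n e a"
    unfolding skew_YB_matrix_def three_Lie_algebra_type_def skew_YB_matrix_axioms_def
    using A basis skew CYBE[unfolded r] by blast
  \<comment> \<open>Of the eleven goals, 4, 8 and 10 are the parameter constraints of the third,
    sixth and seventh family; the others are the bialgebra claims.\<close>
  show ?thesis
  proof (intro conjI impI, goal_cases)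
    case 1
    then interpret skew_YB_matrix3 s br e a
      using M by (simp add: skew_YB_matrix3_def)
    \<comment> \<open>The \<open>D\<close> of the statement and that of the locale are both opened
      to entries of \<open>a\<close>. Without \<open>One_nat_def\<close> the index \<open>1\<close>
      keeps its form and does not become \<open>Suc 0\<close>.\<close>
    from 1 show ?case
      by (intro local_cocycle_bialgebra3I \<Delta>)
        (simp_all only: S_expand E D D_def wedge3_same,
          simp_all add: fun_eq_iff fscale_def a_simps algebra_simps del: One_nat_def)
  next
    case 2
    then interpret skew_YB_matrix4 s br e a
      using M by (simp add: skew_YB_matrix4_def)
    \<comment> \<open>\<open>S\<close> is first split by linearity in its vector, then expanded; the
      wedges are sorted into increasing order and the coefficients compared. The same steps serve
      every four-dimensional family.\<close>
    from 2 show ?case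
      by (intro local_cocycle_bialgebra4I \<Delta>; simp only: S_linear; simp only: S_expand;
          simp only: E D D_def wedge3_same wedge_sort)
        (simp_all add: fun_eq_iff fscale_def a_simps algebra_simps del: One_nat_def)
  next
    case 3
    then interpret skew_YB_matrix4 s br e a
      using M by (simp add: skew_YB_matrix4_def)
    from 3 show ?case
      by (intro local_cocycle_bialgebra4I \<Delta>; simp only: S_linear; simp only: S_expand;
          simp only: E D D_def wedge3_same wedge_sort)
        (simp_all add: fun_eq_iff fscale_def a_simps algebra_simps del: One_nat_def)
  next
    case 4
    then interpret skew_YB_matrix4 s br e a
      using M by (simp add: skew_YB_matrix4_def)
    \<comment> \<open>The functions are the structure constants. One minor remains, with rows 1, 2,
      3 and columns 2, 3, 4; for skew-symmetric \<open>a\<close> it equals \<open>a 2 3\<close>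
      times the Pfaffian of \<open>a\<close>.\<close>
    show ?case
      using YB_component[of "\<lambda>i. of_bool (i = 1)" "\<lambda>i. 0" "\<lambda>i. 0" "\<lambda>i. 0"] 4
      by (simp add: minor_def a_simps algebra_simps del: One_nat_def)
  next
    case 5
    then interpret skew_YB_matrix4 s br e a
      using M by (simp add: skew_YB_matrix4_def)
    from 5 show ?case
      by (intro local_cocycle_bialgebra4I \<Delta>; simp only: S_linear; simp only: S_expand;
          simp only: E D D_def wedge3_same wedge_sort)
        (simp_all add: fun_eq_iff fscale_def a_simps algebra_simps del: One_nat_def)
  next
    case 6
    then interpret skew_YB_matrix4 s br e a
      using M by (simp add: skew_YB_matrix4_def)
    from 6 show ?case
      by (intro local_cocycle_bialgebra4I \<Delta>; simp only: S_linear; simp only: S_expand;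
          simp only: E D D_def wedge3_same wedge_sort)
        (simp_all add: fun_eq_iff fscale_def a_simps algebra_simps del: One_nat_def)
  next
    case 7
    then interpret skew_YB_matrix4 s br e a
      using M by (simp add: skew_YB_matrix4_def)
    from 7 show ?case
      by (intro local_cocycle_bialgebra4I \<Delta>; simp only: S_linear; simp only: S_expand;
          simp only: E D D_def wedge3_same wedge_sort)
        (simp_all add: fun_eq_iff fscale_def a_simps algebra_simps del: One_nat_def)
  next
    case 8
    then interpret skew_YB_matrix4 s br e a
      using M by (simp add: skew_YB_matrix4_def)
    \<comment> \<open>The minor with rows 1, 3, 4 and columns 2, 3, 4 and the one with rows and
      columns exchanged are negatives of each other, so the constraint appears doubled.\<close>
    have "2 * (a 3 4 * (a 1 2 * a 3 4 - a 3 2 * a 1 4 + a 4 2 * a 1 3)) = 0"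
      using YB_component[of "\<lambda>i. 0" "\<lambda>i. 0" "\<lambda>i. of_bool (i = 1)" "\<lambda>i. of_bool (i = 2)"] 8
      by (simp add: minor_def a_simps algebra_simps del: One_nat_def)
    then show ?case by simp
  next
    case 9
    then interpret skew_YB_matrix4 s br e a
      using M by (simp add: skew_YB_matrix4_def)
    from 9 show ?case
      by (intro local_cocycle_bialgebra4I \<Delta>; simp only: S_linear; simp only: S_expand;
          simp only: E D D_def wedge3_same wedge_sort)
        (simp_all add: fun_eq_iff fscale_def a_simps algebra_simps del: One_nat_def)
  next
    case 10
    then interpret skew_YB_matrix4 s br e a
      using M by (simp add: skew_YB_matrix4_def)
    \<comment> \<open>\<open>\<alpha>\<close> multiplies the principal minor on 2, 3, 4, which is
      zero because a skew-symmetric matrix of odd size is singular; so is the one on 1, 3, 4. The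
      minor with rows 2, 3, 4 and columns 1, 3, 4 remains.\<close>
    show ?case
      using YB_component[of "\<lambda>i. 0" "\<lambda>i. 0" "\<lambda>i. of_bool (i = 2)" "\<lambda>i. of_bool (i = 1) * \<alpha> + of_bool (i = 2)"] 10
      by (simp add: minor_def a_simps algebra_simps del: One_nat_def)
  next
    case 11
    then interpret skew_YB_matrix4 s br e a
      using M by (simp add: skew_YB_matrix4_def)
    from 11 show ?case
      by (intro local_cocycle_bialgebra4I \<Delta>; simp only: S_linear; simp only: S_expand;
          simp only: E D D_def wedge3_same wedge_sort)
        (simp_all add: fun_eq_iff fscale_def a_simps algebra_simps del: One_nat_def)
  qed
qed

end
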